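(* Let $k\ge 2$ be an integer, let $G=\mathrm{BS}(1,k)=\langle a,b\mid b^{-1}ab=a^k\rangle$, and let $\mathsf{NF}\subseteq\{a,A,b,B\}^*$ be the set of normal form words for $G$ (where the letters $A,B$ represent $a^{-1},b^{-1}$). For every fixed $g\in G$, the set $$C_g:=\{w\in\mathsf{NF} : wg=_G gw\}$$ is an EDT0L language.
   Context: Notation: $\mathbb N_0=\{0,1,2,\dots\}$. $=_G$ denotes equality of elements of $G$, words being evaluated in $G$ with $A$ representing $a^{-1}$ and $B$ representing $b^{-1}$. Normal form. Let $k\ge2$. For $i,j\in\mathbb Z$, $j\ge 0$, write $a^{i/k^j}$ for the element $b^ja^ib^{-j}$ of $G=\mathrm{BS}(1,k)$ (so $a^q$ is defined for every $q\in\mathbb Z[1/k]$); $A^q$ means $a^{-q}$. Every $g\in G$ can be written as $g=b^r\alpha^u$ with $r\in\mathbb Z$, $\alpha\in\{a,A\}$, and $$u=\frac{i_m}{k^m}+\frac{i_{m-1}}{k^{m-1}}+\cdots+\frac{i_1}{k}+s,\qquad m,s\in\mathbb N_0,\ i_j\in\{0,\dots,k-1\},$$ where either $m=0$ or $i_m\ne0$. The normal form $\mathsf{NF}(g)$ is the word $$b^{t}\,\alpha^{i_m}B\,\alpha^{i_{m-1}}B\cdots\alpha^{i_1}B\,\alpha^s,\qquad t=r+m,$$ over $\{a,A,b,B\}$, where $b^t$ means the word $B^{|t|}$ if $t<0$. Each $g$ has exactly one such word (when $u=0$ the choice of $\alpha$ is immaterial), and $\mathsf{NF}=\{\mathsf{NF}(g):g\in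 G\}$. EDT0L languages. An EDT0L system is a tuple $(\mathcal V,\mathcal U,\mathcal R,v_0)$ where $\mathcal V$ is a finite alphabet, $\mathcal U\subseteq\mathcal V$ is the set of terminals, $v_0\in\mathcal V^*$ is the start word (axiom), and $\mathcal R$ (the rational control) is a regular subset of $\mathcal T^*$ for some finite set $\mathcal T$ of free monoid endomorphisms $\mathcal V^*\to\mathcal V^*$ (called tables). Endomorphisms act on the right, so a string $\tau_1\tau_2\cdots\tau_n\in\mathcal T^*$ is applied by applying $\tau_1$ first, then $\tau_2$, and so on. The language of the system is $\{v\in\mathcal U^*: v=v_0\mathbf r\text{ for some }\mathbf r\in\mathcal R\}$. A language is EDT0L if it is the language of some EDT0L system. *)

theory Defs
  imports Complex_Main "HOL-Algebra.Group"
begin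

inductive regular :: "'x list set \<Rightarrow> bool" where
  empty: "regular {}"
| eps: "regular {[]}"
| letter: "regular {[x]}"
| union: "regular K \<Longrightarrow> regular L \<Longrightarrow> regular (K \<union> L)"
| conc: "regular K \<Longrightarrow> regular L \<Longrightarrow> regular {u @ v | u v. u \<in> K \<and> v \<in> L}"
| star: "regular K \<Longrightarrow> regular (concat ` lists K)"

text \<open>An endomorphism of the free monoid \<open>V\<^sup>*\<close> is given by the images of the letters;
  the values of \<open>\<sigma>\<close> outside \<open>V\<close> are irrelevant.\<close>

definition table_on :: "'v set \<Rightarrow> ('v \<Rightarrow> 'v list) \<Rightarrow> bool" where
  "table_on V \<sigma> \<longleftrightarrow> (\<forall>x\<in>V. \<sigma> x \<in> lists V)"

definition apply_table :: "'v list \<Rightarrow> ('v \<Rightarrow> 'v list) \<Rightarrow> 'v list" where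
  "apply_table w \<sigma> = concat (map \<sigma> w)"

definition apply_tables :: "'v list \<Rightarrow> ('v \<Rightarrow> 'v list) list \<Rightarrow> 'v list" where
  "apply_tables w r = foldl apply_table w r"

definition edt0l_system ::
  "'v set \<Rightarrow> 'v set \<Rightarrow> ('v \<Rightarrow> 'v list) list set \<Rightarrow> 'v list \<Rightarrow> bool" where
  "edt0l_system V U R v0 \<longleftrightarrow>
     finite V \<and> U \<subseteq> V \<and> v0 \<in> lists V \<and>
     (\<exists>T. finite T \<and> (\<forall>\<sigma>\<in>T. table_on V \<sigma>) \<and> R \<subseteq> lists T) \<and> regular R"

definition edt0l_language ::
  "'v set \<Rightarrow> ('v \<Rightarrow> 'v list) list set \<Rightarrow> 'v list \<Rightarrow> 'v list set" where
  "edt0l_language U R v0 = {v \<in> lists U. \<exists>r\<in>R. v = apply_tables v0 r}"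

text \<open>The alphabet of a system for a language over \<open>'x\<close> may contain arbitrarily (finitely) many
  letters outside \<open>'x\<close>; these are taken from the summand \<open>nat\<close>.\<close>

definition EDT0L :: "'x list set \<Rightarrow> bool" where
  "EDT0L L \<longleftrightarrow>
     (\<exists>(V :: ('x + nat) set) U R v0.
        edt0l_system V U R v0 \<and> map Inl ` L = edt0l_language U R v0)"

text \<open>\<open>La, LA, Lb, LB\<close> are the letters \<open>a, A, b, B\<close>.\<close>

datatype letter = La | LA | Lb | LB

inductive bs_eq :: "nat \<Rightarrow> letter list \<Rightarrow> letter list \<Rightarrow> bool" for k where
  refl: "bs_eq k u u"
| sym: "bs_eq k u v \<Longrightarrow> bs_eq k v u"
| trans: "bs_eq k u v \<Longrightarrow> bs_eq k v w \<Longrightarrow> bs_eq k u w"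
| cong: "bs_eq k u v \<Longrightarrow> bs_eq k (x @ u @ y) (x @ v @ y)"
| aA: "bs_eq k [La, LA] []"
| Aa: "bs_eq k [LA, La] []"
| bB: "bs_eq k [Lb, LB] []"
| Bb: "bs_eq k [LB, Lb] []"
| rel: "bs_eq k [LB, La, Lb] (replicate k La)"

definition bs_class :: "nat \<Rightarrow> letter list \<Rightarrow> letter list set" where
  "bs_class k w = {v. bs_eq k w v}"

definition BS :: "nat \<Rightarrow> letter list set monoid" where
  "BS k = \<lparr>carrier = range (bs_class k),
           mult = (\<lambda>X Y. \<Union>x\<in>X. \<Union>y\<in>Y. bs_class k (x @ y)),
           one = bs_class k []\<rparr>"

lemma bs_class_eq_iff: "bs_class k u = bs_class k v \<longleftrightarrow> bs_eq k u v"
proof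
  assume "bs_class k u = bs_class k v"
  then have "v \<in> bs_class k u"
    by (simp add: bs_class_def bs_eq.refl)
  then show "bs_eq k u v"
    by (simp add: bs_class_def)
next
  assume "bs_eq k u v"
  then show "bs_class k u = bs_class k v"
    unfolding bs_class_def using bs_eq.sym[of k u v] bs_eq.trans[of k u v] bs_eq.trans[of k v u]
    by blast
qed

lemma bs_eq_append:
  assumes "bs_eq k u u'" "bs_eq k v v'"
  shows "bs_eq k (u @ v) (u' @ v')"
proof (rule bs_eq.trans)
  show "bs_eq k (u @ v) (u' @ v)"
    using bs_eq.cong[OF assms(1), of "[]" v] by simp
  show "bs_eq k (u' @ v) (u' @ v')"
    using bs_eq.cong[OF assms(2), of u' "[]"] by simp
qed

lemma bs_mult: "bs_class k u \<otimes>\<^bsub>BS k\<^esub> bs_class k v = bs_class k (u @ v)"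
proof -
  have "bs_class k (x @ y) = bs_class k (u @ v)"
    if "x \<in> bs_class k u" "y \<in> bs_class k v" for x y
    unfolding bs_class_eq_iff
    using that by (intro bs_eq.sym[OF bs_eq_append]) (simp_all add: bs_class_def)
  then have "(\<Union>x\<in>bs_class k u. \<Union>y\<in>bs_class k v. bs_class k (x @ y)) =
      (\<Union>x\<in>bs_class k u. \<Union>y\<in>bs_class k v. bs_class k (u @ v))"
    by simp
  moreover have "bs_class k u \<noteq> {}" "bs_class k v \<noteq> {}"
    by (auto simp: bs_class_def intro: bs_eq.refl)
  ultimately show ?thesis
    by (simp add: BS_def)
qed

lemma carrier_BS: "carrier (BS k) = range (bs_class k)"
  by (simp add: BS_def)

lemma bs_class_carrier [simp]: "bs_class k w \<in> carrier (BS k)"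
  by (simp add: BS_def)

lemma bs_one: "\<one>\<^bsub>BS k\<^esub> = bs_class k []"
  by (simp add: BS_def)

fun inv_letter :: "letter \<Rightarrow> letter" where
  "inv_letter La = LA" | "inv_letter LA = La" | "inv_letter Lb = LB" | "inv_letter LB = Lb"

lemma bs_eq_inv_word: "bs_eq k (rev (map inv_letter w) @ w) []"
proof (induction w)
  case (Cons x w)
  have "bs_eq k [inv_letter x, x] []"
    by (cases x) (auto intro: bs_eq.intros(5-8))
  from bs_eq.trans[OF bs_eq.cong[OF this, of "rev (map inv_letter w)" w], of "[]"] Cons.IH
  show ?case
    by simp
qed (simp add: bs_eq.refl)

lemma group_BS: "group (BS k)"
proof (rule groupI)
  fix x assume "x \<in> carrier (BS k)"
  then obtain w where "x = bs_class k w"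
    by (auto simp: carrier_BS)
  then have "bs_class k (rev (map inv_letter w)) \<otimes>\<^bsub>BS k\<^esub> x = \<one>\<^bsub>BS k\<^esub>"
    by (simp add: bs_mult bs_one bs_class_eq_iff bs_eq_inv_word)
  then show "\<exists>y\<in>carrier (BS k). y \<otimes>\<^bsub>BS k\<^esub> x = \<one>\<^bsub>BS k\<^esub>"
    by (meson bs_class_carrier)
qed (auto simp: carrier_BS bs_mult bs_one)

text \<open>\<open>a\<^sup>q\<close> for \<open>q = i / k\<^sup>j\<close> is \<open>b\<^sup>j a\<^sup>i b\<^sup>-\<^sup>j\<close>; \<open>bs_apow_frac\<close> below shows that this is independent of
  the choice of \<open>i\<close> and \<open>j\<close>.\<close>

definition bs_apow :: "nat \<Rightarrow> rat \<Rightarrow> letter list set" where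
  "bs_apow k q = (THE x. \<exists>(i::int) (j::nat). q = of_int i / of_nat k ^ j \<and>
     x = bs_class k [Lb] [^]\<^bsub>BS k\<^esub> j \<otimes>\<^bsub>BS k\<^esub> bs_class k [La] [^]\<^bsub>BS k\<^esub> i
           \<otimes>\<^bsub>BS k\<^esub> inv\<^bsub>BS k\<^esub> (bs_class k [Lb] [^]\<^bsub>BS k\<^esub> j))"

lemma bs_a_pow: "bs_class k [La] [^]\<^bsub>BS k\<^esub> (n::nat) = bs_class k (replicate n La)"
proof (induction n)
  case (Suc n)
  then show ?case
    by (simp add: group.is_monoid[OF group_BS] monoid.nat_pow_Suc bs_mult replicate_append_same)
qed (simp add: bs_one)

lemma bs_conj_pow:
  "bs_class k [Lb] \<otimes>\<^bsub>BS k\<^esub> bs_class k [La] [^]\<^bsub>BS k\<^esub> (i * int k) \<otimes>\<^bsub>BS k\<^esub> inv\<^bsub>BS k\<^esub> bs_class k [Lb]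
     = bs_class k [La] [^]\<^bsub>BS k\<^esub> (i::int)"
proof -
  interpret group "BS k" by (rule group_BS)
  let ?a = "bs_class k [La]" and ?b = "bs_class k [Lb]" and ?B = "bs_class k [LB]"
  let ?c = "\<lambda>x. ?b \<otimes>\<^bsub>BS k\<^esub> x \<otimes>\<^bsub>BS k\<^esub> ?B"
  have bB: "?b \<otimes>\<^bsub>BS k\<^esub> ?B = \<one>\<^bsub>BS k\<^esub>" and Bb: "?B \<otimes>\<^bsub>BS k\<^esub> ?b = \<one>\<^bsub>BS k\<^esub>"
    by (simp_all add: bs_mult bs_one bs_class_eq_iff bs_eq.bB bs_eq.Bb)
  have inv: "inv\<^bsub>BS k\<^esub> ?b = ?B"
    using bB by (simp add: inv_equality Bb)
  have hom: "?c \<in> hom (BS k) (BS k)"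
  proof (rule homI)
    fix x y assume xy: "x \<in> carrier (BS k)" "y \<in> carrier (BS k)"
    have "?c x \<otimes>\<^bsub>BS k\<^esub> ?c y = ?b \<otimes>\<^bsub>BS k\<^esub> x \<otimes>\<^bsub>BS k\<^esub> (?B \<otimes>\<^bsub>BS k\<^esub> ?b) \<otimes>\<^bsub>BS k\<^esub> y \<otimes>\<^bsub>BS k\<^esub> ?B"
      using xy by (simp add: m_assoc)
    then show "?c (x \<otimes>\<^bsub>BS k\<^esub> y) = ?c x \<otimes>\<^bsub>BS k\<^esub> ?c y"
      using xy by (simp add: Bb m_assoc)
  qed simp
  have rel: "?B \<otimes>\<^bsub>BS k\<^esub> ?a \<otimes>\<^bsub>BS k\<^esub> ?b = ?a [^]\<^bsub>BS k\<^esub> k"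
    by (simp add: bs_a_pow bs_mult bs_class_eq_iff bs_eq.rel)
  have "?c (?a [^]\<^bsub>BS k\<^esub> k) = (?b \<otimes>\<^bsub>BS k\<^esub> ?B) \<otimes>\<^bsub>BS k\<^esub> ?a \<otimes>\<^bsub>BS k\<^esub> (?b \<otimes>\<^bsub>BS k\<^esub> ?B)"
    unfolding rel[symmetric] by (simp add: m_assoc)
  then have a: "?c (?a [^]\<^bsub>BS k\<^esub> k) = ?a"
    by (simp add: bB)
  have "?a [^]\<^bsub>BS k\<^esub> (i * int k) = (?a [^]\<^bsub>BS k\<^esub> k) [^]\<^bsub>BS k\<^esub> i"
    by (simp add: int_pow_pow int_pow_int[symmetric] mult.commute)
  then show ?thesis
    using hom_int_pow[OF hom, of "?a [^]\<^bsub>BS k\<^esub> k" i] group_BS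
    by (simp add: inv a int_pow_mult)
qed

lemma bs_conj_frac:
  fixes i :: int and j n :: nat
  shows "bs_class k [Lb] [^]\<^bsub>BS k\<^esub> (j + n) \<otimes>\<^bsub>BS k\<^esub> bs_class k [La] [^]\<^bsub>BS k\<^esub> (i * int k ^ n)
       \<otimes>\<^bsub>BS k\<^esub> inv\<^bsub>BS k\<^esub> (bs_class k [Lb] [^]\<^bsub>BS k\<^esub> (j + n)) =
     bs_class k [Lb] [^]\<^bsub>BS k\<^esub> j \<otimes>\<^bsub>BS k\<^esub> bs_class k [La] [^]\<^bsub>BS k\<^esub> i
       \<otimes>\<^bsub>BS k\<^esub> inv\<^bsub>BS k\<^esub> (bs_class k [Lb] [^]\<^bsub>BS k\<^esub> j)"
proof (induction n)
  case (Suc n)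
  interpret group "BS k" by (rule group_BS)
  let ?a = "bs_class k [La]" and ?b = "bs_class k [Lb]"
  let ?y = "?b [^]\<^bsub>BS k\<^esub> (j + n)" and ?x = "?a [^]\<^bsub>BS k\<^esub> (i * int k ^ Suc n)"
  have x: "?b \<otimes>\<^bsub>BS k\<^esub> ?x \<otimes>\<^bsub>BS k\<^esub> inv\<^bsub>BS k\<^esub> ?b = ?a [^]\<^bsub>BS k\<^esub> (i * int k ^ n)"
    using bs_conj_pow[of k "i * int k ^ n"] by (simp add: ac_simps)
  have "?b [^]\<^bsub>BS k\<^esub> (j + Suc n) \<otimes>\<^bsub>BS k\<^esub> ?x \<otimes>\<^bsub>BS k\<^esub> inv\<^bsub>BS k\<^esub> (?b [^]\<^bsub>BS k\<^esub> (j + Suc n))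
      = ?y \<otimes>\<^bsub>BS k\<^esub> (?b \<otimes>\<^bsub>BS k\<^esub> ?x \<otimes>\<^bsub>BS k\<^esub> inv\<^bsub>BS k\<^esub> ?b) \<otimes>\<^bsub>BS k\<^esub> inv\<^bsub>BS k\<^esub> ?y"
    by (simp add: m_assoc inv_mult_group)
  then show ?case
    unfolding x using Suc.IH by simp
qed simp

lemma bs_apow_frac:
  assumes "k \<ge> 2"
  shows "bs_apow k (of_int i / of_nat k ^ j) =
     bs_class k [Lb] [^]\<^bsub>BS k\<^esub> j \<otimes>\<^bsub>BS k\<^esub> bs_class k [La] [^]\<^bsub>BS k\<^esub> i
       \<otimes>\<^bsub>BS k\<^esub> inv\<^bsub>BS k\<^esub> (bs_class k [Lb] [^]\<^bsub>BS k\<^esub> j)"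
proof -
  let ?x = "\<lambda>(i::int) (j::nat). bs_class k [Lb] [^]\<^bsub>BS k\<^esub> j \<otimes>\<^bsub>BS k\<^esub> bs_class k [La] [^]\<^bsub>BS k\<^esub> i
       \<otimes>\<^bsub>BS k\<^esub> inv\<^bsub>BS k\<^esub> (bs_class k [Lb] [^]\<^bsub>BS k\<^esub> j)"
  have "?x i' j' = ?x i j"
    if eq: "(of_int i :: rat) / of_nat k ^ j = of_int i' / of_nat k ^ j'" for i' j'
  proof -
    have "(of_int (i * int k ^ j') :: rat) = of_int (i' * int k ^ j)"
      using eq assms by (simp add: field_simps)
    then have "i * int k ^ j' = i' * int k ^ j"
      by (simp only: of_int_eq_iff)
    then show ?thesis
      using bs_conj_frac[where k = k and i = i and j = j and n = j']
        bs_conj_frac[where k = k and i = i' and j = j' and n = j] by (simp add: add.commute)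
  qed
  then show ?thesis
    unfolding bs_apow_def by (intro the_equality) blast+
qed

definition b_word :: "int \<Rightarrow> letter list" where
  "b_word t = (if t \<ge> 0 then replicate (nat t) Lb else replicate (nat (- t)) LB)"

text \<open>For \<open>u = 0\<close> both choices of \<open>\<alpha>\<close> give the same word, because then \<open>m = s = 0\<close>.\<close>

definition is_normal_form :: "nat \<Rightarrow> letter list set \<Rightarrow> letter list \<Rightarrow> bool" where
  "is_normal_form k g w \<longleftrightarrow>
     (\<exists>(r::int) \<alpha> (m::nat) (i::nat \<Rightarrow> nat) (s::nat) (u::rat).
        \<alpha> \<in> {La, LA} \<and> (\<forall>j\<in>{1..m}. i j < k) \<and> (m = 0 \<or> i m \<noteq> 0) \<and>
        u = (\<Sum>j=1..m. of_nat (i j) / of_nat k ^ j) + of_nat s \<and>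
        g = bs_class k [Lb] [^]\<^bsub>BS k\<^esub> r \<otimes>\<^bsub>BS k\<^esub> bs_apow k (if \<alpha> = La then u else - u) \<and>
        w = b_word (r + int m) @
            concat (map (\<lambda>j. replicate (i j) \<alpha> @ [LB]) (rev [1..<Suc m])) @
            replicate s \<alpha>)"

definition NF :: "nat \<Rightarrow> letter list set" where
  "NF k = {w. \<exists>g\<in>carrier (BS k). is_normal_form k g w}"

end

theory Submission
  imports Defs
begin

text \<open>\<open>BS(1,k)\<close> is the semidirect product of \<open>\<int>[1/k]\<close> and \<open>\<int>\<close>, and \<open>b\<^sup>r a\<^sup>q\<close> commutes with
  \<open>g = b\<^sup>R a\<^sup>Q\<close> iff \<open>q (k\<^sup>R - 1) = Q (k\<^sup>r - 1)\<close>. If \<open>R = 0 \<noteq> Q\<close>, this says \<open>r = 0\<close>, and the normal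
  forms with \<open>m\<close> digits begin with \<open>b\<^sup>m\<close>. If \<open>R \<noteq> 0\<close> and \<open>P = Q / (k\<^sup>R - 1)\<close> is not \<open>0\<close>, then the
  solutions are \<open>q = P (k\<^sup>r - 1)\<close> with \<open>r\<close> in a cyclic group. Let \<open>d\<close> be its positive generator and
  \<open>K = k\<^sup>d\<close>; for \<open>n > 0\<close> the \<open>n\<close>-th power of the generator of the centralizer has \<open>a\<close>-exponent
  \<open>P (K - 1) (1 + K + \<dots> + K\<^bsup>n-1\<^esup>)\<close>. For large \<open>n\<close> its fractional digits are constant and the unary
  part grows by \<open>c K\<^sup>n\<close>, which a table with \<open>Y \<rightarrow> Y\<^sup>K \<alpha>\<^sup>c\<close> produces. For negative powers the digits,
  read from the left, become periodic and the power of \<open>b\<close> is constant.\<close>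

section \<open>Regular sets and systems with two nonterminals\<close>

text \<open>Each rule brings in only finitely many letters. This supplies the finite set of tables
  that an EDT0L system demands of its control.\<close>

lemma regular_finite_alphabet: "regular L \<Longrightarrow> \<exists>A. finite A \<and> L \<subseteq> lists A"
proof (induction rule: regular.induct)
  case empty
  show ?case by blast
next
  case eps
  show ?case by blast
next
  case (letter x)
  show ?case by (intro exI[of _ "{x}"]) auto
next
  case (union K L)
  then obtain A B where "finite A" "K \<subseteq> lists A" "finite B" "L \<subseteq> lists B" by blast
  then show ?case by (intro exI[of _ "A \<union> B"]) auto
next
  case (conc K L)
  then obtain A B where "finite A" "K \<subseteq> lists A" "finite B" "L \<subseteq> lists B" by blast
  then show ?case by (intro exI[of _ "A \<union> B"]) (auto dest!: subsetD)
next
  case (star K)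
  then obtain A where A: "finite A" "K \<subseteq> lists A" by blast
  have "concat ws \<in> lists A" if "ws \<in> lists K" for ws
    using that A(2) by (induction ws) auto
  then show ?case using A(1) by blast
qed

lemma regular_map: "regular L \<Longrightarrow> regular (map f ` L)"
proof (induction rule: regular.induct)
  case (conc K L)
  have "map f ` {u @ v | u v. u \<in> K \<and> v \<in> L} = {u @ v | u v. u \<in> map f ` K \<and> v \<in> map f ` L}"
    by (auto simp: image_iff) (metis map_append)+
  then show ?case
    using regular.conc[OF conc.IH] by simp
next
  case (star K)
  have "map f ` concat ` lists K = concat ` lists (map f ` K)"
    by (simp add: lists_image image_image map_concat)
  then show ?case
    using regular.star[OF star.IH] by simp
qed (auto simp: image_Un intro: regular.intros)

lemma regular_word: "regular {w}"
proof (induction w)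
  case (Cons x w)
  from regular.conc[OF regular.letter[of x] Cons.IH] show ?case by simp
qed (rule regular.eps)

lemma regular_finite: "finite L \<Longrightarrow> regular L"
proof (induction rule: finite_induct)
  case (insert w L)
  from regular.union[OF regular_word[of w] insert.IH] show ?case by simp
qed (rule regular.empty)

lemma regular_lists:
  assumes "finite A"
  shows "regular (lists A)"
proof -
  have "concat ` lists ((\<lambda>x. [x]) ` A) = lists A"
    by (simp add: lists_image image_image concat_map_singleton)
  moreover have "regular (concat ` lists ((\<lambda>x. [x]) ` A))"
    using assms by (intro regular.star regular_finite) simp
  ultimately show ?thesis by simp
qed

lemma lists_single: "lists {x} = range (\<lambda>n. replicate n x)"
  by auto (metis rangeI replicate_length_same)

lemma regular_powers: "regular (range (\<lambda>n. concat (replicate n w)))"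
  using regular.star[OF regular_word[of w]] by (simp add: lists_single image_image)

lemma regular_letter_powers: "regular (range (\<lambda>n. replicate n x))"
  using regular_lists[of "{x}"] by (simp add: lists_single)

text \<open>The systems used here have two nonterminals \<open>X\<close> and \<open>Y\<close> and start word \<open>X Y\<close>. A table is
  coded by a pair \<open>(u, v)\<close>: it replaces \<open>X\<close> by \<open>u X\<close> and \<open>Y\<close> by \<open>v\<close>, where \<open>None\<close> in \<open>v\<close> stands
  for \<open>Y\<close>. The derivation ends with a table that erases \<open>X\<close> and \<open>Y\<close>.\<close>

type_synonym 'x table_code = "'x list \<times> 'x option list"

text \<open>The head \<open>c\<close> is the table applied first, so each \<open>Y\<close> that it
  leaves is expanded by the remaining codes \<open>cs\<close>.\<close>

primrec derive_Y :: "'x table_code list \<Rightarrow> 'x list" where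
  "derive_Y [] = []"
| "derive_Y (c # cs) =
     concat (map (case_option (derive_Y cs) (\<lambda>x. [x])) (snd c))"

definition derive_XY :: "'x table_code list \<Rightarrow> 'x list" where
  "derive_XY cs = concat (map fst cs) @ derive_Y cs"

text \<open>The control consists of codes instead of tables, so that closure properties reduce to
  those of regular sets.\<close>

definition two_part :: "'x list set \<Rightarrow> bool" where
  "two_part L \<longleftrightarrow> (\<exists>C. regular C \<and> L = derive_XY ` C)"

text \<open>\<open>Inr 0\<close> is X and \<open>Inr 1\<close> is Y; the alphabet used below
  contains no further \<open>Inr n\<close>.\<close>

definition code_table :: "'x table_code \<Rightarrow> 'x + nat \<Rightarrow> ('x + nat) list" where
  "code_table c z = (case z of
       Inl x \<Rightarrow> [Inl x]
     | Inr n \<Rightarrow> if n = 0 then map Inl (fst c) @ [Inr 0]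
                else map (case_option (Inr 1) Inl) (snd c))"

definition erase_table :: "'x + nat \<Rightarrow> ('x + nat) list" where
  "erase_table z = (case z of Inl x \<Rightarrow> [Inl x] | Inr n \<Rightarrow> [])"

lemma code_table_simps [simp]:
  "code_table c (Inl x) = [Inl x]"
  "code_table c (Inr 0) = map Inl (fst c) @ [Inr 0]"
  "code_table c (Inr (Suc 0)) =
    map (case_option (Inr 1) Inl) (snd c)"
  by (simp_all add: code_table_def)

lemma erase_table_simps [simp]: "erase_table (Inl x) = [Inl x]" "erase_table (Inr n) = []"
  by (simp_all add: erase_table_def)

lemma apply_tables_Cons: "apply_tables w (\<sigma> # r) = apply_tables (concat (map \<sigma> w)) r"
  by (simp add: apply_tables_def apply_table_def)

lemma apply_tables_Nil: "apply_tables w [] = w"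
  by (simp add: apply_tables_def)

lemma apply_tables_append: "apply_tables (u @ v) r = apply_tables u r @ apply_tables v r"
  by (induction r arbitrary: u v) (simp_all add: apply_tables_Cons apply_tables_Nil)

lemma apply_tables_letters: "apply_tables w r = concat (map (\<lambda>z. apply_tables [z] r) w)"
proof (induction w)
  case Nil
  show ?case by (induction r) (simp_all add: apply_tables_Cons apply_tables_Nil)
next
  case (Cons z w)
  then show ?case using apply_tables_append[of "[z]" w r] by simp
qed

lemma apply_codes_terminal:
  "apply_tables [Inl x] (map code_table cs @ [erase_table]) = [Inl x]"
  by (induction cs) (simp_all add: apply_tables_Cons apply_tables_Nil)

lemma apply_codes_X:
  "apply_tables [Inr 0] (map code_table cs @ [erase_table]) = map Inl (concat (map fst cs))"
proof (induction cs)
  case (Cons c cs)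
  have "apply_tables (map Inl u) (map code_table cs @ [erase_table]) = map Inl u" for u
    by (subst apply_tables_letters) (simp add: apply_codes_terminal comp_def concat_map_singleton)
  then show ?case
    using Cons.IH by (simp add: apply_tables_Cons apply_tables_append)
qed (simp add: apply_tables_Cons apply_tables_Nil)

lemma apply_codes_Y:
  "apply_tables [Inr 1] (map code_table cs @ [erase_table]) = map Inl (derive_Y cs)"
proof (induction cs)
  case Nil
  show ?case by (simp add: apply_tables_Cons apply_tables_Nil)
next
  case (Cons c cs)
  let ?r = "map code_table cs @ [erase_table]"
  have "apply_tables [case_option (Inr 1) Inl y] ?r =
      map Inl (case_option (derive_Y cs) (\<lambda>x. [x]) y)" for y
    using Cons.IH apply_codes_terminal[of "the y" cs] by (cases y) simp_all
  then have "apply_tables (map (case_option (Inr 1) Inl) v) ?r =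
      map Inl (concat (map (case_option (derive_Y cs) (\<lambda>x. [x])) v))" for v
    unfolding map_concat map_map apply_tables_letters[of "map _ _"] comp_def by presburger
  then show ?case
    by (simp add: apply_tables_Cons)
qed

lemma two_part_EDT0L:
  fixes L :: "'x list set"
  assumes "finite (UNIV :: 'x set)" "two_part L"
  shows "EDT0L L"
proof -
  obtain C where C: "regular C" "L = derive_XY ` C"
    using assms(2) by (auto simp: two_part_def)
  obtain A where A: "finite A" "C \<subseteq> lists A"
    using regular_finite_alphabet[OF C(1)] by blast
  let ?V = "range Inl \<union> {Inr 0, Inr 1} :: ('x + nat) set"
  let ?T = "insert erase_table (code_table ` A)"
  \<comment> \<open>\<open>erase_table\<close> occurs once, at the end, so every control word yields
    a terminal word and the restriction to terminal words discards nothing.\<close>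
  let ?R = "{r @ e | r e. r \<in> map code_table ` C \<and> e \<in> {[erase_table]}}"
  have R: "?R = (\<lambda>cs. map code_table cs @ [erase_table]) ` C"
    by auto
  have "table_on ?V (code_table c)" for c :: "'x table_code"
    by (auto simp: table_on_def code_table_def split: option.splits)
  moreover have "table_on ?V erase_table"
    by (auto simp: table_on_def)
  moreover have "?R \<subseteq> lists ?T"
    using A(2) by (auto dest!: subsetD)
  moreover have "regular ?R"
    by (intro regular.conc regular_map regular_word C(1))
  ultimately have "edt0l_system ?V (range Inl) ?R [Inr 0, Inr 1]"
    unfolding edt0l_system_def using assms(1) A(1)
    by (intro conjI exI[of _ ?T]) auto
  moreover have "apply_tables [Inr 0, Inr 1] (map code_table cs @ [erase_table]) =
      map Inl (derive_XY cs)" for cs :: "'x table_code list"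
    using apply_tables_append[of "[Inr 0]" "[Inr 1]" "map code_table cs @ [erase_table]"]
    by (simp add: apply_codes_X apply_codes_Y[unfolded One_nat_def] derive_XY_def)
  then have "map Inl ` L = edt0l_language (range Inl) ?R [Inr 0, Inr 1]"
    unfolding edt0l_language_def C(2) R by (auto simp del: One_nat_def)
  ultimately show ?thesis
    unfolding EDT0L_def by blast
qed

lemma two_part_Un: "two_part K \<Longrightarrow> two_part L \<Longrightarrow> two_part (K \<union> L)"
  unfolding two_part_def by (metis image_Un regular.union)

lemma two_part_regular:
  assumes "regular L"
  shows "two_part L"
proof -
  \<comment> \<open>X spells the word letter by letter while Y stays idle until it is
    erased.\<close>
  have "derive_XY (map (\<lambda>x. ([x], [None])) w) = w" for w :: "'a list"
    by (induction w) (simp_all add: derive_XY_def)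
  then have "L = derive_XY ` map (\<lambda>x. ([x], [None])) ` L"
    by (simp add: image_image)
  then show ?thesis
    unfolding two_part_def using regular_map[OF assms] by blast
qed

section \<open>Coordinates on the Baumslag-Solitar group\<close>

definition kadic :: "nat \<Rightarrow> rat set" where
  "kadic k = {of_int i / of_nat k ^ j | i j. True}"

lemma kadicI: "of_int i / of_nat k ^ j \<in> kadic k"
  by (auto simp: kadic_def)

lemma kadic_common_denominator:
  assumes "k \<ge> 2" "p \<in> kadic k" "q \<in> kadic k"
  obtains i i' j where "p = of_int i / of_nat k ^ j" "q = of_int i' / of_nat k ^ j"
proof -
  obtain x y x' y' where *: "p = of_int x / of_nat k ^ y" "q = of_int x' / of_nat k ^ y'"
    using assms by (auto simp: kadic_def)
  then have "p = of_int (x * int k ^ y') / of_nat k ^ (y + y')"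
    "q = of_int (x' * int k ^ y) / of_nat k ^ (y + y')"
    using assms(1) by (simp_all add: power_add)
  with that show ?thesis by blast
qed

lemma kadic_add:
  assumes "k \<ge> 2" "p \<in> kadic k" "q \<in> kadic k"
  shows "p + q \<in> kadic k"
proof -
  obtain i i' j where "p = of_int i / of_nat k ^ j" "q = of_int i' / of_nat k ^ j"
    using kadic_common_denominator[OF assms] .
  then have "p + q = of_int (i + i') / of_nat k ^ j"
    by (simp add: add_divide_distrib)
  then show ?thesis
    by (simp only: kadicI)
qed

lemma kadic_diff:
  assumes "k \<ge> 2" "p \<in> kadic k" "q \<in> kadic k"
  shows "p - q \<in> kadic k"
proof -
  obtain i i' j where "p = of_int i / of_nat k ^ j" "q = of_int i' / of_nat k ^ j"
    using kadic_common_denominator[OF assms] .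
  then have "p - q = of_int (i - i') / of_nat k ^ j"
    by (simp add: diff_divide_distrib)
  then show ?thesis
    by (simp only: kadicI)
qed

lemma kadic_int: "of_int i \<in> kadic k"
  using kadicI[of i k 0] by simp

lemma kadic_times_k:
  assumes "p \<in> kadic k"
  shows "p * of_nat k \<in> kadic k"
proof -
  obtain i j where "p = of_int i / of_nat k ^ j"
    using assms by (auto simp: kadic_def)
  then have "p * of_nat k = of_int (i * int k) / of_nat k ^ j"
    by simp
  then show ?thesis
    by (simp only: kadicI)
qed

lemma kadic_divide_k:
  assumes "p \<in> kadic k"
  shows "p / of_nat k \<in> kadic k"
proof -
  obtain i j where "p = of_int i / of_nat k ^ j"
    using assms by (auto simp: kadic_def)
  then have "p / of_nat k = of_int i / of_nat k ^ Suc j"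
    by (simp add: ac_simps)
  then show ?thesis
    by (simp only: kadicI)
qed

lemma kadic_powi:
  assumes "k \<ge> 2" "p \<in> kadic k"
  shows "p * of_nat k powi n \<in> kadic k"
proof -
  have "p * of_nat k ^ m \<in> kadic k" for m
  proof (induction m)
    case (Suc m)
    from kadic_times_k[OF Suc.IH] show ?case by (simp add: ac_simps)
  qed (simp add: assms(2))
  moreover have "p / of_nat k ^ m \<in> kadic k" for m
  proof (induction m)
    case (Suc m)
    from kadic_divide_k[OF Suc.IH] show ?case by (simp add: ac_simps)
  qed (simp add: assms(2))
  ultimately show ?thesis
    by (simp add: power_int_def field_simps)
qed

section \<open>Coordinates of a word in the semidirect product\<close>

primrec letter_bexp :: "letter \<Rightarrow> int" where
  "letter_bexp La = 0" | "letter_bexp LA = 0" | "letter_bexp Lb = 1" | "letter_bexp LB = -1"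

primrec letter_aexp :: "letter \<Rightarrow> rat" where
  "letter_aexp La = 1" | "letter_aexp LA = -1" | "letter_aexp Lb = 0" | "letter_aexp LB = 0"

primrec bexp :: "letter list \<Rightarrow> int" where
  "bexp [] = 0"
| "bexp (x # w) = letter_bexp x + bexp w"

text \<open>\<open>b\<^sup>r a\<^sup>q \<cdot> b\<^sup>s a\<^sup>p = b\<^bsup>r+s\<^esup> a\<^bsup>q'\<^esup>\<close> with \<open>q' = q k\<^sup>s + p\<close>.\<close>

primrec aexp :: "nat \<Rightarrow> letter list \<Rightarrow> rat" where
  "aexp k [] = 0"
| "aexp k (x # w) = letter_aexp x * of_nat k powi bexp w + aexp k w"

lemma bexp_append: "bexp (u @ v) = bexp u + bexp v"
  by (induction u) simp_all

lemma aexp_append: "k \<ge> 2 \<Longrightarrow> aexp k (u @ v) = aexp k u * of_nat k powi bexp v + aexp k v"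
  by (induction u) (simp_all add: bexp_append power_int_add algebra_simps)

lemma bexp_replicate: "bexp (replicate n x) = int n * letter_bexp x"
  by (induction n) (simp_all add: algebra_simps)

lemma aexp_replicate: "letter_bexp x = 0 \<Longrightarrow> aexp k (replicate n x) = of_nat n * letter_aexp x"
  by (induction n) (simp_all add: bexp_replicate algebra_simps)

text \<open>The coordinates of a product depend only on those of its factors, so it suffices to
  check the defining relations.\<close>

lemma bs_eq_imp_exp:
  assumes "k \<ge> 2" "bs_eq k u v"
  shows "bexp u = bexp v \<and> aexp k u = aexp k v"
  using assms(2)
proof (induction rule: bs_eq.induct)
  case (cong u v x y)
  then show ?case
    using assms(1) by (simp add: bexp_append aexp_append)
next
  case rel
  then show ?case
    by (simp add: bexp_replicate aexp_replicate)
qed simp_all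

text \<open>Over a common denominator k^j both factors lie in the same conjugate of the group
  generated by a, where exponents add.\<close>

lemma bs_apow_mult:
  assumes k: "k \<ge> 2" and "p \<in> kadic k" "q \<in> kadic k"
  shows "bs_apow k p \<otimes>\<^bsub>BS k\<^esub> bs_apow k q = bs_apow k (p + q)"
proof -
  interpret group "BS k" by (rule group_BS)
  obtain i i' j where p: "p = of_int i / of_nat k ^ j" and q: "q = of_int i' / of_nat k ^ j"
    using kadic_common_denominator[OF assms] .
  let ?a = "bs_class k [La]" and ?y = "bs_class k [Lb] [^]\<^bsub>BS k\<^esub> j"
  have "bs_apow k p \<otimes>\<^bsub>BS k\<^esub> bs_apow k q =
      ?y \<otimes>\<^bsub>BS k\<^esub> ?a [^]\<^bsub>BS k\<^esub> i \<otimes>\<^bsub>BS k\<^esub> (inv\<^bsub>BS k\<^esub> ?y \<otimes>\<^bsub>BS k\<^esub> ?y) \<otimes>\<^bsub>BS k\<^esub> ?a [^]\<^bsub>BS k\<^esub> i'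
        \<otimes>\<^bsub>BS k\<^esub> inv\<^bsub>BS k\<^esub> ?y"
    unfolding p q bs_apow_frac[OF k]
    by (simp only: m_assoc nat_pow_closed int_pow_closed inv_closed m_closed bs_class_carrier)
  also have "\<dots> = ?y \<otimes>\<^bsub>BS k\<^esub> (?a [^]\<^bsub>BS k\<^esub> i \<otimes>\<^bsub>BS k\<^esub> ?a [^]\<^bsub>BS k\<^esub> i') \<otimes>\<^bsub>BS k\<^esub> inv\<^bsub>BS k\<^esub> ?y"
    by (simp add: l_inv m_assoc)
  also have "\<dots> = ?y \<otimes>\<^bsub>BS k\<^esub> ?a [^]\<^bsub>BS k\<^esub> (i + i') \<otimes>\<^bsub>BS k\<^esub> inv\<^bsub>BS k\<^esub> ?y"
    by (simp add: int_pow_mult)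
  also have "\<dots> = bs_apow k (of_int (i + i') / of_nat k ^ j)"
    by (simp only: bs_apow_frac[OF k])
  finally show ?thesis
    by (simp add: p q add_divide_distrib)
qed

lemma bs_apow_carrier:
  assumes "k \<ge> 2" "p \<in> kadic k"
  shows "bs_apow k p \<in> carrier (BS k)"
proof -
  interpret group "BS k" by (rule group_BS)
  obtain i j where "p = of_int i / of_nat k ^ j"
    using assms(2) by (auto simp: kadic_def)
  then show ?thesis
    by (simp add: bs_apow_frac[OF assms(1)])
qed

lemma bs_apow_conj:
  assumes "k \<ge> 2" "p \<in> kadic k"
  shows "bs_class k [Lb] \<otimes>\<^bsub>BS k\<^esub> bs_apow k p \<otimes>\<^bsub>BS k\<^esub> inv\<^bsub>BS k\<^esub> bs_class k [Lb]
    = bs_apow k (p / of_nat k)"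
proof -
  interpret group "BS k" by (rule group_BS)
  obtain i j where p: "p = of_int i / of_nat k ^ j"
    using assms(2) by (auto simp: kadic_def)
  have "p / of_nat k = of_int i / of_nat k ^ (Suc j)"
    by (simp add: p)
  then have "bs_apow k (p / of_nat k) =
      bs_class k [Lb] [^]\<^bsub>BS k\<^esub> Suc j \<otimes>\<^bsub>BS k\<^esub> bs_class k [La] [^]\<^bsub>BS k\<^esub> i
       \<otimes>\<^bsub>BS k\<^esub> inv\<^bsub>BS k\<^esub> (bs_class k [Lb] [^]\<^bsub>BS k\<^esub> Suc j)"
    by (simp only: bs_apow_frac[OF assms(1)])
  also have "bs_class k [Lb] [^]\<^bsub>BS k\<^esub> Suc j = bs_class k [Lb] \<otimes>\<^bsub>BS k\<^esub> bs_class k [Lb] [^]\<^bsub>BS k\<^esub> j"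
    by (rule nat_pow_Suc2) simp
  finally show ?thesis
    by (simp add: p bs_apow_frac[OF assms(1)] m_assoc inv_mult_group)
qed

lemma bs_inv_class: "inv\<^bsub>BS k\<^esub> bs_class k [La] = bs_class k [LA]"
  "inv\<^bsub>BS k\<^esub> bs_class k [Lb] = bs_class k [LB]"
proof -
  interpret group "BS k" by (rule group_BS)
  show "inv\<^bsub>BS k\<^esub> bs_class k [La] = bs_class k [LA]"
    by (rule inv_equality) (simp_all add: bs_mult bs_one bs_class_eq_iff bs_eq.Aa)
  show "inv\<^bsub>BS k\<^esub> bs_class k [Lb] = bs_class k [LB]"
    by (rule inv_equality) (simp_all add: bs_mult bs_one bs_class_eq_iff bs_eq.Bb)
qed

lemma bs_apow_int:
  assumes "k \<ge> 2"
  shows "bs_apow k (of_int i) = bs_class k [La] [^]\<^bsub>BS k\<^esub> i"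
proof -
  interpret group "BS k" by (rule group_BS)
  show ?thesis
    using bs_apow_frac[OF assms, of i 0] by simp
qed

text \<open>Hence the coordinates determine the group element, the converse of
  \<open>bs_eq_imp_exp\<close>. Appending a or A shifts the exponent of a by 1 or -1; appending b or
  B moves that letter left past a power of a, whose exponent is multiplied or divided by k.\<close>

lemma bs_class_eq_exp:
  assumes k: "k \<ge> 2"
  shows "aexp k w \<in> kadic k \<and>
    bs_class k w = bs_class k [Lb] [^]\<^bsub>BS k\<^esub> bexp w \<otimes>\<^bsub>BS k\<^esub> bs_apow k (aexp k w)"
proof (induction w rule: rev_induct)
  case Nil
  interpret group "BS k" by (rule group_BS)
  show ?case
    using bs_apow_int[OF k, of 0] kadic_int[of 0 k] by (simp add: bs_one)
next
  case (snoc x w)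
  interpret group "BS k" by (rule group_BS)
  let ?b = "bs_class k [Lb]" and ?r = "bexp w" and ?q = "aexp k w"
  have q: "?q \<in> kadic k"
    and w: "bs_class k w = ?b [^]\<^bsub>BS k\<^esub> ?r \<otimes>\<^bsub>BS k\<^esub> bs_apow k ?q"
    using snoc.IH by auto
  have carr: "bs_apow k p \<in> carrier (BS k)" if "p \<in> kadic k" for p
    using bs_apow_carrier[OF k that] .
  have wx: "bs_class k (w @ [x]) = ?b [^]\<^bsub>BS k\<^esub> ?r \<otimes>\<^bsub>BS k\<^esub> bs_apow k ?q \<otimes>\<^bsub>BS k\<^esub> bs_class k [x]"
    by (simp only: bs_mult[symmetric] w)
  show ?case
  proof (cases x)
    case La
    have "bs_class k [La] = bs_apow k 1"
      using bs_apow_int[OF k, of 1] by simp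
    moreover have "(1 :: rat) \<in> kadic k"
      using kadic_int[of 1 k] by simp
    ultimately show ?thesis
      using wx k q carr bs_apow_mult[OF k q, of 1] kadic_add[OF k q, of 1]
      by (simp add: La bexp_append aexp_append m_assoc)
  next
    case LA
    have "bs_class k [LA] = bs_apow k (-1)"
      using bs_apow_int[OF k, of "-1"] by (simp add: bs_inv_class int_pow_neg)
    moreover have "(-1 :: rat) \<in> kadic k"
      using kadic_int[of "-1" k] by simp
    ultimately show ?thesis
      using wx k q carr bs_apow_mult[OF k q, of "-1"] kadic_add[OF k q, of "-1"]
      by (simp add: LA bexp_append aexp_append m_assoc)
  next
    case Lb
    note q' = kadic_times_k[OF q]
    have "bs_apow k ?q = ?b \<otimes>\<^bsub>BS k\<^esub> bs_apow k (?q * of_nat k) \<otimes>\<^bsub>BS k\<^esub> inv\<^bsub>BS k\<^esub> ?b"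
      using bs_apow_conj[OF k q'] k by simp
    then have "bs_apow k ?q \<otimes>\<^bsub>BS k\<^esub> ?b = ?b \<otimes>\<^bsub>BS k\<^esub> bs_apow k (?q * of_nat k)"
      using carr[OF q'] by (simp add: m_assoc)
    moreover have "?b [^]\<^bsub>BS k\<^esub> (?r + 1) = ?b [^]\<^bsub>BS k\<^esub> ?r \<otimes>\<^bsub>BS k\<^esub> ?b"
      by (simp add: int_pow_mult int_pow_1)
    ultimately show ?thesis
      using wx k q carr[OF q] carr[OF q'] q'
      by (simp add: Lb bexp_append aexp_append m_assoc)
  next
    case LB
    note q' = kadic_divide_k[OF q]
    have "bs_apow k ?q \<otimes>\<^bsub>BS k\<^esub> inv\<^bsub>BS k\<^esub> ?b = inv\<^bsub>BS k\<^esub> ?b \<otimes>\<^bsub>BS k\<^esub> bs_apow k (?q / of_nat k)"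
      unfolding bs_apow_conj[OF k q, symmetric] using carr[OF q]
      by (simp add: m_assoc[symmetric])
    moreover have "?b [^]\<^bsub>BS k\<^esub> (?r - 1) = ?b [^]\<^bsub>BS k\<^esub> ?r \<otimes>\<^bsub>BS k\<^esub> inv\<^bsub>BS k\<^esub> ?b"
      by (simp add: int_pow_diff)
    ultimately show ?thesis
      using wx k q carr[OF q] carr[OF q'] q'
      by (simp add: LB bexp_append aexp_append m_assoc bs_inv_class power_int_minus field_simps)
  qed
qed

lemma bs_class_eq_iff_exp:
  assumes "k \<ge> 2"
  shows "bs_class k u = bs_class k v \<longleftrightarrow> bexp u = bexp v \<and> aexp k u = aexp k v"
  using bs_eq_imp_exp[OF assms] bs_class_eq_exp[OF assms] bs_class_eq_iff by metis

lemma bs_commute_iff: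
  assumes "k \<ge> 2"
  shows "bs_class k u \<otimes>\<^bsub>BS k\<^esub> bs_class k v = bs_class k v \<otimes>\<^bsub>BS k\<^esub> bs_class k u \<longleftrightarrow>
    aexp k u * (of_nat k powi bexp v - 1) = aexp k v * (of_nat k powi bexp u - 1)"
  using assms by (simp add: bs_mult bs_class_eq_iff_exp bexp_append aexp_append algebra_simps)

section \<open>Normal forms\<close>

text \<open>The part of the normal form after the power of \<open>b\<close>, for \<open>u = p / k\<^sup>m\<close>: the digits
  \<open>i\<^sub>m, \<dots>, i\<^sub>1\<close> are the lowest \<open>m\<close> digits of \<open>p\<close> in base \<open>k\<close>, beginning with the lowest.\<close>

primrec digit_word :: "nat \<Rightarrow> letter \<Rightarrow> nat \<Rightarrow> nat \<Rightarrow> letter list" where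
  "digit_word k \<alpha> 0 p = replicate p \<alpha>"
| "digit_word k \<alpha> (Suc m) p = replicate (p mod k) \<alpha> @ LB # digit_word k \<alpha> m (p div k)"

primrec low_digits :: "nat \<Rightarrow> letter \<Rightarrow> nat \<Rightarrow> nat \<Rightarrow> letter list" where
  "low_digits k \<alpha> 0 p = []"
| "low_digits k \<alpha> (Suc m) p = replicate (p mod k) \<alpha> @ LB # low_digits k \<alpha> m (p div k)"

text \<open>For m > 0 the digit i_m is \<open>p mod k\<close>, so this is the condition m = 0 or i_m
  \<noteq> 0.\<close>

definition reduced :: "nat \<Rightarrow> nat \<Rightarrow> nat \<Rightarrow> bool" where
  "reduced k m p \<longleftrightarrow> m = 0 \<or> \<not> k dvd p"

primrec digits_value :: "nat \<Rightarrow> nat list \<Rightarrow> nat \<Rightarrow> nat" where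
  "digits_value k [] s = s"
| "digits_value k (d # ds) s = d + k * digits_value k ds s"

lemma digit_word_value:
  assumes "k \<ge> 2" "set ds \<subseteq> {..<k}"
  shows "digit_word k \<alpha> (length ds) (digits_value k ds s) =
    concat (map (\<lambda>d. replicate d \<alpha> @ [LB]) ds) @ replicate s \<alpha>"
  using assms by (induction ds) simp_all

lemma reduced_digits:
  assumes "k \<ge> 2" "set ds \<subseteq> {..<k}"
  shows "reduced k (length ds) (digits_value k ds s) \<longleftrightarrow> ds = [] \<or> hd ds \<noteq> 0"
  using assms by (cases ds) (auto simp: reduced_def dvd_eq_mod_eq_0)

lemma ex_digits:
  assumes "k \<ge> 2"
  shows "\<exists>ds s. length ds = m \<and> set ds \<subseteq> {..<k} \<and> digits_value k ds s = p"
proof (induction m arbitrary: p)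
  case 0
  show ?case by (intro exI[of _ "[]"] exI[of _ p]) simp
next
  case (Suc m)
  obtain ds s where "length ds = m \<and> set ds \<subseteq> {..<k} \<and> digits_value k ds s = p div k"
    using Suc.IH by blast
  then show ?case
    using assms by (intro exI[of _ "p mod k # ds"] exI[of _ s]) simp
qed

text \<open>Passes from the number p to digit lists, which a regular control can generate. The
  length is kept because the leading power of b depends on it.\<close>

lemma digit_words_by_digits:
  assumes "k \<ge> 2"
  shows "{(m, digit_word k \<alpha> m p) | m p. reduced k m p} =
    {(length ds, concat (map (\<lambda>d. replicate d \<alpha> @ [LB]) ds) @ replicate s \<alpha>) | ds s.
       set ds \<subseteq> {..<k} \<and> (ds = [] \<or> hd ds \<noteq> 0)}" (is "?L = ?R")
proof (intro equalityI subsetI)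
  fix x assume "x \<in> ?L"
  then obtain m p where mp: "x = (m, digit_word k \<alpha> m p)" "reduced k m p" by blast
  obtain ds s where "length ds = m" "set ds \<subseteq> {..<k}" "digits_value k ds s = p"
    using ex_digits[OF assms] by blast
  then show "x \<in> ?R"
    using mp digit_word_value[OF assms, of ds \<alpha> s] reduced_digits[OF assms, of ds s] by auto
next
  fix x assume "x \<in> ?R"
  then obtain ds s where ds: "set ds \<subseteq> {..<k}" "ds = [] \<or> hd ds \<noteq> 0"
    and x: "x = (length ds, concat (map (\<lambda>d. replicate d \<alpha> @ [LB]) ds) @ replicate s \<alpha>)"
    by blast
  then show "x \<in> ?L"
    using digit_word_value[OF assms ds(1), of \<alpha> s] reduced_digits[OF assms ds(1), of s] by force
qed

lemma letter_bexp_eq_0: "\<alpha> \<in> {La, LA} \<Longrightarrow> letter_bexp \<alpha> = 0"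
  by auto

lemma bexp_digit_word: "\<alpha> \<in> {La, LA} \<Longrightarrow> bexp (digit_word k \<alpha> m p) = - int m"
  by (induction m arbitrary: p) (simp_all add: bexp_append bexp_replicate letter_bexp_eq_0)

lemma aexp_digit_word:
  assumes "k \<ge> 2" "\<alpha> \<in> {La, LA}"
  shows "aexp k (digit_word k \<alpha> m p) = letter_aexp \<alpha> * of_nat p / of_nat k ^ m"
proof (induction m arbitrary: p)
  case 0
  show ?case by (simp add: aexp_replicate[OF letter_bexp_eq_0[OF assms(2)]])
next
  case (Suc m)
  have "of_nat p = (of_nat (p mod k) + of_nat (p div k) * of_nat k :: rat)"
    by (metis mod_div_mult_eq of_nat_add of_nat_mult)
  then show ?case
    using assms(1) Suc.IH[of "p div k"]
    by (simp add: aexp_append bexp_digit_word[OF assms(2)]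
        aexp_replicate[OF letter_bexp_eq_0[OF assms(2)]]
        power_int_diff power_int_minus field_simps)
qed

lemma bexp_b_word: "bexp (b_word t) = t"
  by (simp add: b_word_def bexp_replicate)

lemma aexp_b_word: "aexp k (b_word t) = 0"
proof -
  have "aexp k (replicate n x) = 0" if "letter_aexp x = 0" for n x
    using that by (induction n) simp_all
  then show ?thesis by (simp add: b_word_def)
qed

text \<open>A set with at most one element, which is empty when q is not in Z[1/k]; this avoids
  partial functions.\<close>

definition nf_words :: "nat \<Rightarrow> int \<Rightarrow> rat \<Rightarrow> letter list set" where
  "nf_words k r q = {b_word (r + int m) @ digit_word k \<alpha> m p | \<alpha> m p.
     \<alpha> \<in> {La, LA} \<and> reduced k m p \<and> letter_aexp \<alpha> * of_nat p / of_nat k ^ m = q}"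

lemma nf_words_exp:
  assumes "k \<ge> 2" "w \<in> nf_words k r q"
  shows "bexp w = r \<and> aexp k w = q"
  using assms unfolding nf_words_def
  by (auto simp: bexp_append aexp_append bexp_b_word aexp_b_word bexp_digit_word aexp_digit_word)

lemma kadic_digit_sum: "k \<ge> 2 \<Longrightarrow>
  (\<Sum>j=1..m. of_nat (i j) / of_nat k ^ j) + of_nat s \<in> kadic k"
proof (induction m)
  case 0
  show ?case using kadic_int[of "int s" k] by simp
next
  case (Suc m)
  have "of_nat (i (Suc m)) / of_nat k ^ Suc m \<in> kadic k"
    using kadicI[of "int (i (Suc m))" k "Suc m"] by simp
  from kadic_add[OF Suc.prems this Suc.IH[OF Suc.prems]] show ?case
    by (simp add: ac_simps)
qed

lemma NF_eq:
  assumes k: "k \<ge> 2"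
  shows "NF k = (\<Union>r q. nf_words k r q)"
proof (intro equalityI subsetI)
  fix w assume "w \<in> NF k"
  then obtain r \<alpha> m i s where \<alpha>: "\<alpha> \<in> {La, LA}" and i: "\<forall>j\<in>{1..m}. i j < k"
    and im: "m = 0 \<or> i m \<noteq> (0 :: nat)"
    and w: "w = b_word (r + int m) @
      concat (map (\<lambda>j. replicate (i j) \<alpha> @ [LB]) (rev [1..<Suc m])) @ replicate s \<alpha>"
    unfolding NF_def is_normal_form_def by blast
  let ?ds = "map i (rev [1..<Suc m])"
  have ds: "set ?ds \<subseteq> {..<k}"
    using i by auto
  have "?ds = [] \<or> hd ?ds \<noteq> 0"
    using im by (cases m) auto
  moreover have "w = b_word (r + int (length ?ds)) @
      digit_word k \<alpha> (length ?ds) (digits_value k ?ds s)"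
    unfolding digit_word_value[OF k ds] w by (simp add: comp_def del: upt_Suc)
  ultimately show "w \<in> (\<Union>r q. nf_words k r q)"
    using \<alpha> reduced_digits[OF k ds, of s] unfolding nf_words_def by blast
next
  fix w assume "w \<in> (\<Union>r q. nf_words k r q)"
  then obtain r \<alpha> m p where \<alpha>: "\<alpha> \<in> {La, LA}" and red: "reduced k m p"
    and w: "w = b_word (r + int m) @ digit_word k \<alpha> m p"
    unfolding nf_words_def by blast
  obtain ds s where ds: "length ds = m" "set ds \<subseteq> {..<k}" "digits_value k ds s = p"
    using ex_digits[OF k] by blast
  \<comment> \<open>The leftmost digit has the highest index: for m > 0, \<open>i m\<close> is the
    head of \<open>ds\<close> and \<open>i 1\<close> its last entry.\<close>
  define i where "i j = ds ! (m - j)" for j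
  have map: "map i (rev [1..<Suc m]) = ds"
    by (rule nth_equalityI) (auto simp: i_def rev_nth ds(1) simp del: upt_Suc)
  have "w = b_word (r + int m) @
      concat (map (\<lambda>j. replicate (i j) \<alpha> @ [LB]) (rev [1..<Suc m])) @ replicate s \<alpha>"
    unfolding w digit_word_value[OF k ds(2), of \<alpha> s, unfolded ds(1,3)] map[symmetric]
    by (simp add: comp_def del: upt_Suc)
  moreover have "\<forall>j\<in>{1..m}. ds ! (m - j) \<in> set ds"
    using ds(1) by (auto intro!: nth_mem)
  then have "\<forall>j\<in>{1..m}. i j < k"
    using ds(2) by (auto simp: i_def)
  moreover have "m = 0 \<or> i m \<noteq> 0"
    using red reduced_digits[OF k ds(2), of s] ds by (cases ds) (auto simp: i_def)
  moreover
  let ?u = "(\<Sum>j=1..m. of_nat (i j) / of_nat k ^ j) + of_nat s :: rat"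
  let ?g = "bs_class k [Lb] [^]\<^bsub>BS k\<^esub> r \<otimes>\<^bsub>BS k\<^esub> bs_apow k (if \<alpha> = La then ?u else - ?u)"
  interpret group "BS k" by (rule group_BS)
  have "- ?u \<in> kadic k"
    using kadic_diff[OF k kadic_int[of 0] kadic_digit_sum[OF k, of i m s]] by simp
  then have "?g \<in> carrier (BS k)"
    using bs_apow_carrier[OF k] kadic_digit_sum[OF k, of i m s] by auto
  ultimately show "w \<in> NF k"
    unfolding NF_def is_normal_form_def using \<alpha> by blast
qed

text \<open>After clearing denominators and cancelling the smaller power of k, unequal denominators
  would make k divide the numerator over the larger one.\<close>

lemma reduced_unique:
  assumes k: "k \<ge> 2" and red: "reduced k m p" "reduced k m' p'"
    and eq: "(of_nat p :: rat) / of_nat k ^ m = of_nat p' / of_nat k ^ m'"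
  shows "m = m' \<and> p = p'"
proof -
  have "of_nat (p * k ^ m') = (of_nat (p' * k ^ m) :: rat)"
    using eq k by (simp add: field_simps)
  then have e: "p * k ^ m' = p' * k ^ m"
    by (simp only: of_nat_eq_iff)
  have *: False if e: "x * k ^ a = y * k ^ b" and r: "reduced k b x" and ab: "a < b" for x y a b
  proof -
    obtain d where b: "b = Suc d + a"
      using ab less_imp_Suc_add by (metis add.commute add_Suc)
    have "x * k ^ a = y * k ^ Suc d * k ^ a"
      using e unfolding b by (simp add: power_add ac_simps)
    then have "x = y * k ^ Suc d"
      using k by simp
    then show False
      using r ab by (simp add: reduced_def)
  qed
  have "m = m'"
    using *[OF e red(1)] *[OF e[symmetric] red(2)] by (meson linorder_neqE_nat)
  then show ?thesis
    using e k by simp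
qed

lemma nf_words_unique:
  assumes k: "k \<ge> 2" and "w \<in> nf_words k r q" "w' \<in> nf_words k r q"
  shows "w = w'"
proof -
  obtain \<alpha> m p where 1: "\<alpha> \<in> {La, LA}" "reduced k m p" "letter_aexp \<alpha> * of_nat p / of_nat k ^ m = q"
    and w: "w = b_word (r + int m) @ digit_word k \<alpha> m p"
    using assms(2) by (auto simp: nf_words_def)
  obtain \<alpha>' m' p' where 2: "\<alpha>' \<in> {La, LA}" "reduced k m' p'"
      "letter_aexp \<alpha>' * of_nat p' / of_nat k ^ m' = q"
    and w': "w' = b_word (r + int m') @ digit_word k \<alpha>' m' p'"
    using assms(3) by (auto simp: nf_words_def)
  have "\<bar>letter_aexp \<alpha>\<bar> = 1" "\<bar>letter_aexp \<alpha>'\<bar> = 1"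
    using 1(1) 2(1) by auto
  then have "(of_nat p :: rat) / of_nat k ^ m = \<bar>q\<bar>" "(of_nat p' :: rat) / of_nat k ^ m' = \<bar>q\<bar>"
    using 1(3) 2(3) by (metis abs_divide abs_mult abs_of_nat power_abs mult_1)+
  then have eq: "m = m'" "p = p'"
    using reduced_unique[OF k 1(2) 2(2)] by simp_all
  \<comment> \<open>For p = 0 the sign does not determine the letter, but reducedness then forces m
    = 0 and no such letter is written.\<close>
  show ?thesis
  proof (cases "p = 0")
    case True
    then have "m = 0" using 1(2) by (simp add: reduced_def)
    then show ?thesis using True eq w w' by simp
  next
    case False
    moreover have "letter_aexp \<alpha> * of_nat p = letter_aexp \<alpha>' * of_nat p"
      using 1(3) 2(3) eq k by (auto simp: divide_eq_eq)
    ultimately have "letter_aexp \<alpha> = letter_aexp \<alpha>'"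
      by simp
    then have "\<alpha> = \<alpha>'"
      using 1(1) 2(1) by auto
    then show ?thesis using eq w w' by simp
  qed
qed

lemma finite_nf_words: "k \<ge> 2 \<Longrightarrow> finite (nf_words k r q)"
  by (rule finite_subset[of _ "{SOME w. w \<in> nf_words k r q}"])
    (auto intro: nf_words_unique someI)

section \<open>Languages of normal forms\<close>

definition digit_codes :: "nat \<Rightarrow> nat option list set" where
  "digit_codes k = {map Some ds @ replicate s None | ds s.
     set ds \<subseteq> {..<k} \<and> (ds = [] \<or> hd ds \<noteq> 0)}"

lemma regular_digit_codes: "regular (digit_codes k)"
proof -
  let ?S = "{u @ v | u v. u \<in> (\<lambda>i. [Some i]) ` {1..<k} \<and> v \<in> lists (Some ` {..<k})}"
  let ?N = "range (\<lambda>n. replicate n (None :: nat option))"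
  have leading: "{map Some ds | ds. set ds \<subseteq> {..<k} \<and> (ds = [] \<or> hd ds \<noteq> 0)} = {[]} \<union> ?S" (is "?L = _")
  proof (intro equalityI subsetI)
    fix w assume "w \<in> ?L"
    then obtain ds where ds: "w = map Some ds" "set ds \<subseteq> {..<k}" "ds = [] \<or> hd ds \<noteq> 0"
      by blast
    show "w \<in> {[]} \<union> ?S"
    proof (cases ds)
      case (Cons d ds')
      then have "w = [Some d] @ map Some ds'" "d \<in> {1..<k}" "map Some ds' \<in> lists (Some ` {..<k})"
        using ds by (auto simp: lists_image)
      then show ?thesis by blast
    qed (simp add: ds(1))
  next
    fix w assume "w \<in> {[]} \<union> ?S"
    then consider "w = []" | i v where "w = [Some i] @ v" "i \<in> {1..<k}" "v \<in> lists (Some ` {..<k})"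
      by blast
    then show "w \<in> ?L"
    proof cases
      case 2
      then obtain ds where "v = map Some ds" "set ds \<subseteq> {..<k}"
        by (auto simp: lists_image simp del: in_lists_conv_set)
      then show ?thesis
        using 2 by (intro CollectI exI[of _ "i # ds"]) auto
    qed auto
  qed
  have "digit_codes k = {u @ v | u v. u \<in> {[]} \<union> ?S \<and> v \<in> ?N}"
    unfolding leading[symmetric] digit_codes_def by auto
  moreover have "regular ({[]} \<union> ?S)"
    by (intro regular.union regular.eps regular.conc regular_lists regular_finite) auto
  note regular.conc[OF this regular_letter_powers]
  ultimately show ?thesis
    by simp
qed

text \<open>\<open>e\<close> is what X emits for each digit: \<open>[Lb]\<close> lets X count the
  digits, \<open>[]\<close> keeps it silent.\<close>

definition digit_code :: "letter list \<Rightarrow> letter \<Rightarrow> nat option \<Rightarrow> letter table_code" where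
  "digit_code e \<alpha> c = (case c of
       Some d \<Rightarrow> (e, map Some (replicate d \<alpha> @ [LB]) @ [None])
     | None \<Rightarrow> ([], [Some \<alpha>, None]))"

lemma derive_Y_append_None: "derive_Y ((u, map Some v @ [None]) # cs) = v @ derive_Y cs"
  by (induction v) auto

lemma derive_XY_digit_code:
  "derive_XY (map (digit_code e \<alpha>) (map Some ds @ replicate s None)) =
    concat (replicate (length ds) e) @ concat (map (\<lambda>d. replicate d \<alpha> @ [LB]) ds) @ replicate s \<alpha>"
proof -
  have "derive_Y (map (digit_code e \<alpha>) (replicate s None)) = replicate s \<alpha>"
    by (induction s) (simp_all add: digit_code_def)
  then have "derive_Y (map (digit_code e \<alpha>) (map Some ds @ replicate s None)) =
      concat (map (\<lambda>d. replicate d \<alpha> @ [LB]) ds) @ replicate s \<alpha>"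
  proof (induction ds)
    case (Cons d ds)
    then show ?case
      using derive_Y_append_None[of e "replicate d \<alpha> @ [LB]"]
      by (simp add: digit_code_def[of e \<alpha> "Some d"])
  qed simp
  moreover have "concat (map fst (map (digit_code e \<alpha>) (map Some ds @ replicate s None))) =
      concat (replicate (length ds) e)"
    by (induction ds) (simp_all add: digit_code_def map_replicate_const)
  ultimately show ?thesis
    by (simp add: derive_XY_def)
qed

lemma derive_XY_digit_codes:
  assumes "k \<ge> 2"
  shows "derive_XY ` map (digit_code e \<alpha>) ` digit_codes k =
    {concat (replicate m e) @ digit_word k \<alpha> m p | m p. reduced k m p}"
proof -
  let ?f = "\<lambda>(m, v). concat (replicate m e) @ v"
  have "{concat (replicate m e) @ digit_word k \<alpha> m p | m p. reduced k m p} =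
      ?f ` {(m, digit_word k \<alpha> m p) | m p. reduced k m p}"
    by force
  also have "\<dots> = ?f ` {(length ds, concat (map (\<lambda>d. replicate d \<alpha> @ [LB]) ds) @ replicate s \<alpha>) | ds s.
       set ds \<subseteq> {..<k} \<and> (ds = [] \<or> hd ds \<noteq> 0)}"
    by (simp only: digit_words_by_digits[OF assms])
  also have "\<dots> = {derive_XY (map (digit_code e \<alpha>) (map Some ds @ replicate s None)) | ds s.
       set ds \<subseteq> {..<k} \<and> (ds = [] \<or> hd ds \<noteq> 0)}"
    unfolding derive_XY_digit_code by (auto simp: image_iff) fastforce+
  also have "\<dots> = derive_XY ` map (digit_code e \<alpha>) ` digit_codes k"
    unfolding digit_codes_def by blast
  finally show ?thesis ..
qed

text \<open>For r = 0 the initial power of b has length m. X emits one b for each B written by Y,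
  which keeps the two counts equal.\<close>

lemma two_part_nf_words_exponent_0:
  assumes "k \<ge> 2"
  shows "two_part (\<Union>q. nf_words k 0 q)"
proof -
  have "two_part {concat (replicate m [Lb]) @ digit_word k \<alpha> m p | m p. reduced k m p}" for \<alpha>
    unfolding two_part_def derive_XY_digit_codes[OF assms, symmetric]
    using regular_map[OF regular_digit_codes] by blast
  from two_part_Un[OF this[of La] this[of LA]] show ?thesis
    by (rule back_subst[of two_part]) (auto simp: nf_words_def b_word_def concat_replicate_single)
qed

lemma b_word_range: "range b_word = range (\<lambda>n. replicate n Lb) \<union> range (\<lambda>n. replicate n LB)"
proof -
  have "b_word t \<in> range (\<lambda>n. replicate n Lb) \<union> range (\<lambda>n. replicate n LB)" for t
    by (simp add: b_word_def)
  moreover have "replicate n Lb = b_word (int n)" "replicate n LB = b_word (- int n)" for n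
    by (auto simp: b_word_def)
  ultimately show ?thesis
    by blast
qed

lemma regular_b_words: "regular (range b_word)"
  unfolding b_word_range by (intro regular.union regular_letter_powers)

text \<open>Codes in which X spells u and Y stays unchanged precede the codes for v.\<close>

lemma two_part_regular_append:
  assumes "regular K" "two_part L"
  shows "two_part {u @ v | u v. u \<in> K \<and> v \<in> L}"
proof -
  let ?f = "map (\<lambda>x. ([x], [None :: 'a option]))"
  obtain C where C: "regular C" "L = derive_XY ` C"
    using assms(2) by (auto simp: two_part_def)
  have f: "derive_XY (?f u @ cs) = u @ derive_XY cs" for u cs
    by (induction u) (simp_all add: derive_XY_def)
  have "derive_XY ` {u @ v | u v. u \<in> ?f ` K \<and> v \<in> C} = {derive_XY (?f u @ cs) | u cs. u \<in> K \<and> cs \<in> C}"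
    by blast
  also have "\<dots> = {u @ v | u v. u \<in> K \<and> v \<in> L}"
    unfolding C(2) f by blast
  finally have "{u @ v | u v. u \<in> K \<and> v \<in> L} = derive_XY ` {u @ v | u v. u \<in> ?f ` K \<and> v \<in> C}" ..
  then show ?thesis
    unfolding two_part_def
    using regular.conc[OF regular_map[OF assms(1), of "\<lambda>x. ([x], [None])"] C(1)]
    by (intro exI conjI)
qed

text \<open>As r is free, the initial power of b is arbitrary and independent of the digits.\<close>

lemma two_part_all_nf_words:
  assumes "k \<ge> 2"
  shows "two_part (\<Union>r q. nf_words k r q)"
proof -
  let ?D = "\<lambda>\<alpha>. {digit_word k \<alpha> m p | m p. reduced k m p}"
  have D: "two_part (?D \<alpha>)" for \<alpha>
  proof -
    have "?D \<alpha> = derive_XY ` map (digit_code [] \<alpha>) ` digit_codes k"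
      using derive_XY_digit_codes[OF assms, of "[]" \<alpha>] by simp
    then show ?thesis
      unfolding two_part_def using regular_map[OF regular_digit_codes] by blast
  qed
  have "(\<Union>r q. nf_words k r q) = {u @ v | u v. u \<in> range b_word \<and> v \<in> ?D La \<union> ?D LA}" (is "?L = ?R")
  proof (intro equalityI subsetI)
    fix w assume "w \<in> ?L"
    then obtain r \<alpha> m p where "w = b_word (r + int m) @ digit_word k \<alpha> m p" "reduced k m p" "\<alpha> \<in> {La, LA}"
      unfolding nf_words_def by blast
    then show "w \<in> ?R" by blast
  next
    fix w assume "w \<in> ?R"
    then obtain t \<alpha> m p where *: "w = b_word t @ digit_word k \<alpha> m p" "reduced k m p" "\<alpha> \<in> {La, LA}"
      by blast
    then have "w \<in> nf_words k (t - int m) (letter_aexp \<alpha> * of_nat p / of_nat k ^ m)"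
      unfolding nf_words_def
      by (intro CollectI exI[of _ \<alpha>] exI[of _ m] exI[of _ p]) simp
    then show "w \<in> ?L" by blast
  qed
  then show ?thesis
    using two_part_regular_append[OF regular_b_words two_part_Un[OF D[of La] D[of LA]]] by simp
qed

lemma two_part_nf_words_0:
  assumes "k \<ge> 2"
  shows "two_part (\<Union>r. nf_words k r 0)"
proof -
  have "b_word r \<in> nf_words k r 0" for r
    unfolding nf_words_def
    by (intro CollectI exI[of _ La] exI[of _ "0::nat"]) (simp add: reduced_def)
  then have "nf_words k r 0 = {b_word r}" for r
    using nf_words_unique[OF assms] by auto
  then have "(\<Union>r. nf_words k r 0) = range b_word"
    by auto
  then show ?thesis
    by (simp add: two_part_regular regular_b_words)
qed

section \<open>Geometric sums and their base-k digits\<close>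

primrec repunit :: "nat \<Rightarrow> nat \<Rightarrow> nat" where
  "repunit K 0 = 0"
| "repunit K (Suc n) = 1 + K * repunit K n"

lemma repunit_add: "repunit K (a + b) = repunit K a + K ^ a * repunit K b"
  by (induction a) (simp_all add: algebra_simps)

lemma repunit_times: "(of_nat K - 1) * of_nat (repunit K n) = (of_nat K ^ n - 1 :: rat)"
  by (induction n) (simp_all add: algebra_simps)

lemma digit_word_add:
  "k \<ge> 2 \<Longrightarrow> digit_word k \<alpha> (a + b) x = low_digits k \<alpha> a x @ digit_word k \<alpha> b (x div k ^ a)"
  by (induction a arbitrary: x) (simp_all add: div_mult2_eq)

lemma low_digits_add_mult: "low_digits k \<alpha> a (x + k ^ a * y) = low_digits k \<alpha> a x"
proof (induction a arbitrary: x)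
  case (Suc a)
  show ?case
    using Suc.IH[of "x div k"] by (cases "k = 0") (simp_all add: mult.assoc add.commute)
qed simp

text \<open>A multiple of k^m does not touch the m lowest digits; it only lengthens the unary
  tail.\<close>

lemma digit_word_add_mult:
  assumes "k > 0"
  shows "digit_word k \<alpha> m (x + k ^ m * y) = digit_word k \<alpha> m x @ replicate y \<alpha>"
proof (induction m arbitrary: x)
  case (Suc m)
  show ?case
    using Suc.IH[of "x div k"] assms by (simp add: mult.assoc add.commute)
qed (simp add: replicate_add)

section \<open>Powers of one element\<close>

text \<open>Let K = k^r. As \<open>m \<le> r * n\<close>, k^m divides K^n, so from n on the digits
  are frozen and only the tail grows, by \<open>c * repunit K j\<close> with c = p K^n / k^m. The
  recursion of \<open>repunit\<close> is the table Y -> Y^K \<alpha>^c, and X emits b^r in each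
  step.\<close>

lemma two_part_repunits:
  assumes "k \<ge> 2" "m \<le> r * n"
  shows "two_part (range (\<lambda>j. replicate (t + r * j) Lb @
    digit_word k \<alpha> m (p * repunit (k ^ r) (n + j))))"
proof -
  let ?K = "k ^ r"
  define c where "c = p * k ^ (r * n - m)"
  let ?F = "digit_word k \<alpha> m (p * repunit ?K n)"
  let ?start = "(replicate t Lb, map Some ?F @ [None])"
  let ?step = "(replicate r Lb, replicate ?K None @ replicate c (Some \<alpha>))"
  have k: "k > 0"
    using assms(1) by simp
  from assms(2) have "?K ^ n = k ^ m * k ^ (r * n - m)"
    by (simp flip: power_mult power_add)
  then have "p * repunit ?K (n + j) = p * repunit ?K n + k ^ m * (c * repunit ?K j)" for j
    unfolding repunit_add c_def by (simp only: algebra_simps)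
  then have word: "digit_word k \<alpha> m (p * repunit ?K (n + j)) = ?F @ replicate (c * repunit ?K j) \<alpha>" for j
    by (simp add: digit_word_add_mult[OF k])
  have rep: "concat (replicate a (replicate b x)) = replicate (a * b) x" for a b and x :: letter
    by (induction a) (simp_all add: replicate_add)
  have Y_step: "derive_Y (?step # cs) = concat (replicate ?K (derive_Y cs)) @ replicate c \<alpha>" for cs
    by (simp add: comp_def concat_map_singleton concat_replicate_single)
  have Y: "derive_Y (replicate j ?step) = replicate (c * repunit ?K j) \<alpha>" for j
  proof (induction j)
    case (Suc j)
    then show ?case
      by (simp only: replicate_Suc Y_step rep) (simp add: algebra_simps flip: replicate_add)
  qed simp
  have "derive_XY (?start # replicate j ?step) =
      replicate (t + r * j) Lb @ digit_word k \<alpha> m (p * repunit ?K (n + j))" for j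
    using derive_Y_append_None[of "replicate t Lb" ?F]
    by (simp add: derive_XY_def Y word rep replicate_add mult.commute del: derive_Y.simps)
  then have "range (\<lambda>j. replicate (t + r * j) Lb @ digit_word k \<alpha> m (p * repunit ?K (n + j))) =
      derive_XY ` range (\<lambda>j. ?start # replicate j ?step)"
    by (simp only: image_image)
  moreover have "range (\<lambda>j. ?start # replicate j ?step) =
      {u @ v | u v. u \<in> {[?start]} \<and> v \<in> range (\<lambda>j. replicate j ?step)}"
    by auto
  moreover have "regular {u @ v | u v. u \<in> {[?start]} \<and> v \<in> range (\<lambda>j. replicate j ?step)}"
    by (intro regular.conc regular.letter regular_letter_powers)
  ultimately show ?thesis
    unfolding two_part_def by (intro exI conjI) simp_all
qed

text \<open>Adding \<open>c\<close> to a number \<open>p + k\<^sup>r x\<close> leaves the carry \<open>(c + p) div k\<^sup>r\<close> after \<open>r\<close> digits. The carries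
  increase and are bounded by \<open>p\<close>, hence they become constant, and then the digits repeat.\<close>

lemma regular_repunits:
  assumes "k \<ge> 2" "r > 0" "c \<le> p" "c \<le> (c + p) div k ^ r"
  shows "regular (range (\<lambda>j. digit_word k \<alpha> (m + r * j) (c + p * repunit (k ^ r) (n + j))))"
  using assms(3,4)
\<comment> \<open>The measure is the room left for the carry to grow.\<close>
proof (induction "p - c" arbitrary: c rule: less_induct)
  case less
  let ?K = "k ^ r" and ?d = "(c + p) div k ^ r"
  let ?w = "\<lambda>c j. digit_word k \<alpha> (m + r * j) (c + p * repunit (k ^ r) (n + j))"
  have K: "?K \<ge> 2"
    using self_le_power[of k r] assms(1,2) by linarith
  \<comment> \<open>With x = \<open>repunit ?K (n + j)\<close>, c + p (1 + K x) = (c + p) + K p x.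
    Its r lowest digits are those of c + p, and its quotient by K is the same expression with carry
    \<open>?d\<close>.\<close>
  have step: "?w c (Suc j) = low_digits k \<alpha> r (c + p) @ ?w ?d j" for j
  proof -
    have "?w c (Suc j) = digit_word k \<alpha> (r + (m + r * j)) (c + p + ?K * (p * repunit ?K (n + j)))"
      by (simp add: algebra_simps)
    also have "\<dots> = low_digits k \<alpha> r (c + p) @ ?w ?d j"
      using assms(1)
      by (simp only: digit_word_add[OF assms(1), of _ r] low_digits_add_mult)
        (simp add: add.commute)
    finally show ?thesis .
  qed
  show ?case
  proof (cases "?d = c")
    case True
    have "?w c j = concat (replicate j (low_digits k \<alpha> r (c + p))) @ ?w c 0" for j
      using step unfolding True by (induction j) simp_all
    then have "range (?w c) = {u @ v | u v.
        u \<in> range (\<lambda>j. concat (replicate j (low_digits k \<alpha> r (c + p)))) \<and> v \<in> {?w c 0}}"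
      by auto
    then show ?thesis
      using regular.conc[OF regular_powers[of "low_digits k \<alpha> r (c + p)"]
          regular_word[of "?w c 0"]]
      by simp
  next
    case False
    with less.prems have "c < ?d" by simp
    \<comment> \<open>Since c \<le> p and K \<ge> 2, the new carry is again at most p.\<close>
    moreover have "?d \<le> (2 * p) div 2"
      using div_le_mono[of "c + p" "2 * p" 2] div_le_mono2[of 2 ?K "c + p"] less.prems(1) K by simp
    moreover have "?d \<le> (?d + p) div ?K"
      using less.prems(2) by (intro div_le_mono) simp
    ultimately have reg: "regular (range (?w ?d))"
      by (intro less.hyps) auto
    have range: "range (?w c) =
        {?w c 0} \<union> {u @ v | u v. u \<in> {low_digits k \<alpha> r (c + p)} \<and> v \<in> range (?w ?d)}"
    proof -
      have "range f = {f 0} \<union> range (\<lambda>j. f (Suc j))" for f :: "nat \<Rightarrow> letter list"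
        by (auto simp: image_iff) (metis not0_implies_Suc)
      from this[of "?w c"] have "range (?w c) = {?w c 0} \<union> range (\<lambda>j. ?w c (Suc j))" .
      then show ?thesis
        unfolding step by auto
    qed
    show ?thesis
      unfolding range by (intro regular.union regular.conc regular_word reg)
  qed
qed

lemma ex_reduced:
  assumes "k \<ge> 2"
  shows "\<exists>m p. reduced k m p \<and> (of_nat n :: rat) / of_nat k ^ j = of_nat p / of_nat k ^ m"
proof (induction j arbitrary: n)
  case 0
  show ?case
    by (intro exI[of _ 0] exI[of _ n]) (simp add: reduced_def)
next
  case (Suc j)
  show ?case
  proof (cases "k dvd n")
    case True
    then obtain n' where "n = k * n'" by blast
    then have "(of_nat n :: rat) / of_nat k ^ Suc j = of_nat n' / of_nat k ^ j"
      using assms by simp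
    then show ?thesis
      using Suc.IH[of n'] by simp
  next
    case False
    then show ?thesis
      by (intro exI[of _ "Suc j"] exI[of _ n]) (simp add: reduced_def)
  qed
qed

lemma kadic_reduced:
  assumes k: "k \<ge> 2" and "q \<in> kadic k"
  obtains \<alpha> m p where "\<alpha> \<in> {La, LA}" "reduced k m p" "q = letter_aexp \<alpha> * of_nat p / of_nat k ^ m"
proof -
  obtain i j where q: "q = of_int i / of_nat k ^ j"
    using assms(2) by (auto simp: kadic_def)
  obtain m p where mp: "reduced k m p"
      "(of_nat (nat \<bar>i\<bar>) :: rat) / of_nat k ^ j = of_nat p / of_nat k ^ m"
    using ex_reduced[OF k] by blast
  show thesis
  proof (cases "i \<ge> 0")
    case True
    then have "q = letter_aexp La * of_nat p / of_nat k ^ m"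
      using mp(2) by (simp add: q)
    then show ?thesis
      using that[of La m p] mp(1) by simp
  next
    case False
    then have "q = letter_aexp LA * of_nat p / of_nat k ^ m"
      using mp(2) by (simp add: q)
    then show ?thesis
      using that[of LA m p] mp(1) by simp
  qed
qed

lemma ex_power_factor:
  fixes k p :: nat
  assumes "k \<ge> 2" "p > 0"
  shows "\<exists>j q. p = k ^ j * q \<and> \<not> k dvd q"
  using assms(2)
proof (induction p rule: less_induct)
  case (less p)
  show ?case
  proof (cases "k dvd p")
    case True
    then obtain p' where p': "p = k * p'" by blast
    then obtain j q where "p' = k ^ j * q \<and> \<not> k dvd q"
      using less assms(1) by fastforce
    then show ?thesis
      by (intro exI[of _ "Suc j"] exI[of _ q]) (simp add: p')
  next
    case False
    then show ?thesis
      by (intro exI[of _ 0] exI[of _ p]) simp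
  qed
qed

text \<open>As r and n are positive, the repunit is congruent to 1 modulo k.\<close>

lemma reduced_times_repunit:
  assumes "reduced k m p" "r > 0" "n > 0"
  shows "reduced k m (p * repunit (k ^ r) n)"
proof -
  obtain n' r' where "n = Suc n'" "r = Suc r'"
    using assms(2,3) by (metis gr0_implies_Suc)
  then have "p * repunit (k ^ r) n = p + k * (k ^ r' * p * repunit (k ^ r) n')"
    by (simp add: algebra_simps)
  then show ?thesis
    using assms(1) unfolding reduced_def by (metis dvd_add_left_iff dvd_triv_left)
qed

lemma nf_words_eq:
  assumes "k \<ge> 2" "\<alpha> \<in> {La, LA}" "reduced k m p" "letter_aexp \<alpha> * of_nat p / of_nat k ^ m = q"
  shows "nf_words k r q = {b_word (r + int m) @ digit_word k \<alpha> m p}"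
proof -
  have "b_word (r + int m) @ digit_word k \<alpha> m p \<in> nf_words k r q"
    using assms(2-4) unfolding nf_words_def by blast
  then show ?thesis
    using nf_words_unique[OF assms(1)] by blast
qed

text \<open>If \<open>q = P (k\<^sup>r - 1)\<close> is in \<open>\<int>[1/k]\<close>, then this contains only the normal form of
  \<open>(b\<^sup>r a\<^sup>q)\<^sup>n\<close>.\<close>

definition power_words :: "nat \<Rightarrow> nat \<Rightarrow> rat \<Rightarrow> int \<Rightarrow> letter list set" where
  "power_words k r P n = nf_words k (int r * n) (P * (of_nat k powi (int r * n) - 1))"

text \<open>Both rest on \<open>repunit_times\<close> for K = k^r. The second uses k^(-rn) - 1 =
  -(k^(rn) - 1) / k^(rn), which reverses the sign and brings in a denominator.\<close>

lemma power_words_exponent: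
  fixes P :: rat
  assumes "k \<ge> 2"
  shows "P * (of_nat k powi (int r * int n) - 1) = P * (of_nat k ^ r - 1) * of_nat (repunit (k ^ r) n)"
    "P * (of_nat k powi (int r * - int n) - 1) =
      - (P * (of_nat k ^ r - 1) * of_nat (repunit (k ^ r) n)) / of_nat k ^ (r * n)"
proof -
  have "(of_nat k ^ r - 1 :: rat) * of_nat (repunit (k ^ r) n) = of_nat k ^ (r * n) - 1"
    using repunit_times[of "k ^ r" n] by (simp add: power_mult)
  then have *: "P * (of_nat k ^ r - 1) * of_nat (repunit (k ^ r) n) = P * (of_nat k ^ (r * n) - 1)"
    by (simp only: mult.assoc)
  have powi: "(of_nat k :: rat) powi (int r * int n) = of_nat k ^ (r * n)"
    by (simp flip: of_nat_mult)
  show "P * (of_nat k powi (int r * int n) - 1) =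
      P * (of_nat k ^ r - 1) * of_nat (repunit (k ^ r) n)"
    by (simp only: * powi)
  have "(of_nat k :: rat) powi (int r * - int n) = inverse (of_nat k ^ (r * n))"
    by (simp only: mult_minus_right power_int_minus powi)
  then show "P * (of_nat k powi (int r * - int n) - 1) =
      - (P * (of_nat k ^ r - 1) * of_nat (repunit (k ^ r) n)) / of_nat k ^ (r * n)"
    unfolding * using assms by (simp add: field_simps)
qed

text \<open>The repunit factor keeps the fraction reduced, so the denominator k^m is the same for
  all n > 0, and \<open>two_part_repunits\<close> applies.\<close>

lemma two_part_positive_powers:
  assumes k: "k \<ge> 2" and r: "r > 0" and "P * (of_nat k ^ r - 1) \<in> kadic k"
  shows "\<exists>N. two_part (\<Union>j. power_words k r P (int (N + j)))"
proof -
  obtain \<alpha> m p where \<alpha>: "\<alpha> \<in> {La, LA}" and red: "reduced k m p"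
    and P: "P * (of_nat k ^ r - 1) = letter_aexp \<alpha> * of_nat p / of_nat k ^ m"
    using kadic_reduced[OF assms(1,3)] by blast
  have words: "power_words k r P (int n) =
      {replicate (r * n + m) Lb @ digit_word k \<alpha> m (p * repunit (k ^ r) n)}" if "n > 0" for n
  proof -
    have "letter_aexp \<alpha> * of_nat (p * repunit (k ^ r) n) / of_nat k ^ m =
        P * (of_nat k powi (int r * int n) - 1)"
      unfolding power_words_exponent(1)[OF k] P by simp
    from nf_words_eq[OF k \<alpha> reduced_times_repunit[OF red r that] this, of "int r * int n"]
    have "power_words k r P (int n) = {b_word (int r * int n + int m) @ digit_word k \<alpha> m (p * repunit (k ^ r) n)}"
      by (simp only: power_words_def)
    moreover have "b_word (int r * int n + int m) = replicate (r * n + m) Lb"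
      by (simp add: b_word_def flip: of_nat_mult of_nat_add)
    ultimately show ?thesis by simp
  qed
  \<comment> \<open>With r \<ge> 1 this gives \<open>m \<le> r * ?n\<close>, from where the digits
    are frozen; it also makes every power positive.\<close>
  let ?n = "Suc m"
  have "power_words k r P (int (?n + j)) =
      {replicate ((r * ?n + m) + r * j) Lb @ digit_word k \<alpha> m (p * repunit (k ^ r) (?n + j))}" for j
    using words[of "?n + j"] by (simp add: algebra_simps)
  then have union: "(\<Union>j. power_words k r P (int (?n + j))) = range (\<lambda>j.
      replicate ((r * ?n + m) + r * j) Lb @ digit_word k \<alpha> m (p * repunit (k ^ r) (?n + j)))"
    by blast
  have "m \<le> r * ?n"
    using r by (cases r) auto
  then have "two_part (\<Union>j. power_words k r P (int (?n + j)))"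
    unfolding union by (rule two_part_repunits[OF k])
  then show ?thesis ..
qed

text \<open>The denominator grows exactly as fast as the exponent of b falls, so the initial power
  of b is constantly m - d. The digits are covered by \<open>regular_repunits\<close>.\<close>

lemma two_part_negative_powers:
  assumes k: "k \<ge> 2" and r: "r > 0" and "P * (of_nat k ^ r - 1) \<in> kadic k" and "P \<noteq> 0"
  shows "\<exists>N. two_part (\<Union>j. power_words k r P (- int (N + j)))"
proof -
  obtain \<alpha> m p where \<alpha>: "\<alpha> \<in> {La, LA}" and red: "reduced k m p"
    and P: "P * (of_nat k ^ r - 1) = letter_aexp \<alpha> * of_nat p / of_nat k ^ m"
    using kadic_reduced[OF assms(1,3)] by blast
  have "(of_nat k :: rat) ^ r > 1"
    using k r by simp
  then have "p > 0"
    using P assms(4) by (cases p) auto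
  \<comment> \<open>For m = 0 the numerator may be divisible by k; then k^d must cancel against the
    new denominator.\<close>
  then obtain d q where p: "p = k ^ d * q" and q: "\<not> k dvd q"
    using ex_power_factor[OF k] by blast
  let ?\<beta> = "inv_letter \<alpha>"
  have \<beta>: "?\<beta> \<in> {La, LA}" "letter_aexp ?\<beta> = - letter_aexp \<alpha>"
    using \<alpha> by auto
  have le: "d \<le> m + r * n" if "d \<le> n" for n
    using that r by (cases r) auto
  have words: "power_words k r P (- int n) =
      {b_word (int m - int d) @ digit_word k ?\<beta> (m + r * n - d) (q * repunit (k ^ r) n)}"
    if "d \<le> n" "n > 0" for n
  proof -
    \<comment> \<open>The exponent 1 makes this say just that k does not divide q, which passes to
      any other exponent.\<close>
    have "reduced k 1 q"
      using q by (simp add: reduced_def)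
    from reduced_times_repunit[OF this r that(2)]
    have red': "reduced k (m + r * n - d) (q * repunit (k ^ r) n)"
      by (simp add: reduced_def)
    have kd: "(of_nat k :: rat) ^ (m + r * n - d) = of_nat k ^ m * of_nat k ^ (r * n) / of_nat k ^ d"
      using k le[OF that(1)] by (simp add: power_diff power_add)
    have "letter_aexp ?\<beta> * of_nat (q * repunit (k ^ r) n) / of_nat k ^ (m + r * n - d) =
        P * (of_nat k powi (int r * - int n) - 1)"
      unfolding power_words_exponent(2)[OF k] P p \<beta>(2) kd using k by (simp add: field_simps)
    from nf_words_eq[OF k \<beta>(1) red' this, of "int r * - int n"]
    have "power_words k r P (- int n) = {b_word (int r * - int n + int (m + r * n - d)) @
        digit_word k ?\<beta> (m + r * n - d) (q * repunit (k ^ r) n)}"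
      by (simp only: power_words_def)
    moreover have "int r * - int n + int (m + r * n - d) = int m - int d"
      using le[OF that(1)] by (simp add: of_nat_diff)
    ultimately show ?thesis by simp
  qed
  \<comment> \<open>This ensures \<open>d \<le> m + r * ?n\<close>, so the natural subtraction is
    exact. The 0 in \<open>?w\<close> is the initial carry.\<close>
  let ?n = "Suc d"
  let ?w = "\<lambda>j. digit_word k ?\<beta> ((m + r * ?n - d) + r * j) (0 + q * repunit (k ^ r) (?n + j))"
  have "power_words k r P (- int (?n + j)) = {b_word (int m - int d) @ ?w j}" for j
  proof -
    have "m + r * (?n + j) - d = (m + r * ?n - d) + r * j"
      using le[of ?n] by (simp add: algebra_simps)
    then show ?thesis
      using words[of "?n + j"] by simp
  qed
  then have union: "(\<Union>j. power_words k r P (- int (?n + j))) =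
      {u @ v | u v. u \<in> {b_word (int m - int d)} \<and> v \<in> range ?w}"
    by auto
  have "regular (range ?w)"
    using k r by (intro regular_repunits) auto
  then have "two_part (\<Union>j. power_words k r P (- int (?n + j)))"
    unfolding union by (intro two_part_regular regular.conc regular_word)
  then show ?thesis ..
qed

text \<open>Between the two infinite families only finitely many powers remain, each with at most
  one word.\<close>

lemma two_part_powers:
  assumes k: "k \<ge> 2" and r: "r > 0" and "P * (of_nat k ^ r - 1) \<in> kadic k" and "P \<noteq> 0"
  shows "two_part (\<Union>n. power_words k r P n)"
proof -
  obtain M N where M: "two_part (\<Union>j. power_words k r P (int (M + j)))"
    and N: "two_part (\<Union>j. power_words k r P (- int (N + j)))"
    using two_part_positive_powers[OF assms(1-3)] two_part_negative_powers[OF assms] by blast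
  have "(\<Union>n. power_words k r P n) = (\<Union>n\<in>{- int N..int M}. power_words k r P n) \<union>
      (\<Union>j. power_words k r P (int (M + j))) \<union> (\<Union>j. power_words k r P (- int (N + j)))"
    (is "_ = ?R")
  proof (intro equalityI UN_least)
    fix n
    consider "n \<in> {- int N..int M}" | "n > int M" | "n < - int N" by fastforce
    then show "power_words k r P n \<subseteq> ?R"
    proof cases
      case 2
      then have "n = int (M + nat (n - int M))"
        by simp
      then obtain j where "n = int (M + j)" ..
      then show ?thesis by blast
    next
      case 3
      then have "n = - int (N + nat (- n - int N))"
        by simp
      then obtain j where "n = - int (N + j)" ..
      then show ?thesis by blast
    qed blast
  qed blast
  moreover have "finite (\<Union>n\<in>{- int N..int M}. power_words k r P n)"
    unfolding power_words_def by (intro finite_UN_I finite_nf_words[OF k]) simp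
  ultimately show ?thesis
    by (simp only: two_part_Un two_part_regular regular_finite M N)
qed

text \<open>The exponents \<open>r\<close> with \<open>P (k\<^sup>r - 1) \<in> \<int>[1/k]\<close> form a subgroup of \<open>\<int>\<close>.\<close>

lemma ex_exponent_generator:
  assumes k: "k \<ge> 2" and "R \<noteq> 0" "P * (of_nat k powi R - 1) \<in> kadic k"
  shows "\<exists>r>0. P * (of_nat k ^ r - 1) \<in> kadic k \<and>
    (\<forall>x. P * (of_nat k powi x - 1) \<in> kadic k \<longrightarrow> int r dvd x)"
proof -
  define S where "S = {x. P * (of_nat k powi x - 1) \<in> kadic k}"
  have diff: "x - y \<in> S" if "x \<in> S" "y \<in> S" for x y
  proof -
    \<comment> \<open>The difference is rescaled by k^(-y), a unit of Z[1/k].\<close>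
    have "P * (of_nat k powi (x - y) - 1) =
        (P * (of_nat k powi x - 1) - P * (of_nat k powi y - 1)) * of_nat k powi (- y)"
      using k by (simp add: power_int_diff power_int_minus field_simps)
    then show ?thesis
      using that kadic_powi[OF k kadic_diff[OF k]] by (simp add: S_def)
  qed
  have zero: "0 \<in> S"
    using kadic_int[of 0 k] by (simp add: S_def)
  have neg: "- x \<in> S" if "x \<in> S" for x
    using diff[OF zero that] by simp
  have add: "x + y \<in> S" if "x \<in> S" "y \<in> S" for x y
    using diff[OF that(1) neg[OF that(2)]] by simp
  define r where "r = (LEAST n. n > 0 \<and> int n \<in> S)"
  have "nat \<bar>R\<bar> > 0 \<and> int (nat \<bar>R\<bar>) \<in> S"
    using assms(2,3) neg[of R] by (auto simp: S_def abs_if)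
  then have r: "r > 0 \<and> int r \<in> S"
    unfolding r_def by (rule LeastI)
  have mult: "int r * int n \<in> S" for n
    using r zero add by (induction n) (simp_all add: algebra_simps)
  have "int r dvd x" if "x \<in> S" for x
  proof -
    have "int r * (x div int r) \<in> S"
      using mult[of "nat (x div int r)"] neg[OF mult[of "nat (- (x div int r))"]]
      by (cases "x div int r \<ge> 0") simp_all
    from diff[OF that this] have "x mod int r \<in> S"
      by (simp add: minus_mult_div_eq_mod)
    moreover have "x mod int r \<ge> 0" "x mod int r < int r"
      using r by simp_all
    ultimately have "\<not> nat (x mod int r) > 0"
      using not_less_Least[of "nat (x mod int r)" "\<lambda>n. n > 0 \<and> int n \<in> S"]
      by (auto simp flip: r_def)
    then show ?thesis
      using \<open>x mod int r \<ge> 0\<close> by (simp add: dvd_eq_mod_eq_0)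
  qed
  with r show ?thesis
    unfolding S_def by (intro exI[of _ r]) auto
qed

lemma nf_words_kadic:
  assumes "k \<ge> 2" "w \<in> nf_words k r q"
  shows "q \<in> kadic k"
  using nf_words_exp[OF assms] bs_class_eq_exp[OF assms(1), of w] by simp

text \<open>For r outside the multiples of the generator the exponent of a is not in Z[1/k], so
  these sets are empty.\<close>

lemma two_part_cyclic:
  assumes k: "k \<ge> 2" and "R \<noteq> 0" "P \<noteq> 0" and R: "P * (of_nat k powi R - 1) \<in> kadic k"
  shows "two_part (\<Union>r. nf_words k r (P * (of_nat k powi r - 1)))"
proof -
  obtain r where r: "r > 0" "P * (of_nat k ^ r - 1) \<in> kadic k"
    and dvd: "\<And>x. P * (of_nat k powi x - 1) \<in> kadic k \<Longrightarrow> int r dvd x"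
    using ex_exponent_generator[OF k assms(2) R] by blast
  have "(\<Union>x. nf_words k x (P * (of_nat k powi x - 1))) = (\<Union>n. power_words k r P n)"
  proof (intro equalityI subsetI)
    fix w assume "w \<in> (\<Union>x. nf_words k x (P * (of_nat k powi x - 1)))"
    then obtain x where x: "w \<in> nf_words k x (P * (of_nat k powi x - 1))" by blast
    then obtain n where "x = int r * n"
      using dvd[OF nf_words_kadic[OF k]] by blast
    then show "w \<in> (\<Union>n. power_words k r P n)"
      using x unfolding power_words_def by blast
  qed (auto simp: power_words_def)
  then show ?thesis
    using two_part_powers[OF k r assms(3)] by simp
qed

lemma finite_letters: "finite (UNIV :: letter set)"
proof -
  have "(UNIV :: letter set) = {La, LA, Lb, LB}"
    using letter.exhaust by auto
  then show ?thesis
    by (metis finite.emptyI finite_insert)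
qed

section \<open>Case distinction on the coordinates of g\<close>

theorem proposition8:
  fixes k :: nat and g :: "letter list set"
  assumes "k \<ge> 2" and "g \<in> carrier (BS k)"
  shows "EDT0L {w \<in> NF k. bs_class k w \<otimes>\<^bsub>BS k\<^esub> g = g \<otimes>\<^bsub>BS k\<^esub> bs_class k w}"
    (is "EDT0L ?C")
proof -
  note k = assms(1)
  obtain h where g: "g = bs_class k h"
    using assms(2) by (auto simp: carrier_BS)
  define R Q where "R = bexp h" and "Q = aexp k h"
  have C: "w \<in> ?C \<longleftrightarrow> (\<exists>r q. w \<in> nf_words k r q \<and>
      q * (of_nat k powi R - 1) = Q * (of_nat k powi r - 1))" for w
    unfolding NF_eq[OF k] g using nf_words_exp[OF k, of w]
    by (auto simp: bs_commute_iff[OF k] R_def Q_def)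
  have powi_eq_1: "(of_nat k :: rat) powi n = 1 \<longleftrightarrow> n = 0" for n
  proof (cases n "0 :: int" rule: linorder_cases)
    case less
    then have "(of_nat k :: rat) powi (- n) > 1"
      using k by (intro one_less_power_int) simp_all
    then show ?thesis
      using less by (auto simp: power_int_minus)
  next
    case greater
    then have "(of_nat k :: rat) powi n > 1"
      using k by (intro one_less_power_int) simp_all
    then show ?thesis
      using greater by simp
  qed simp
  \<comment> \<open>For R = 0 the equation reads Q (k^r - 1) = 0: no condition if Q = 0, and r = 0
    otherwise.\<close>
  have "two_part ?C"
  proof (cases "R = 0")
    case True
    show ?thesis
    proof (cases "Q = 0")
      case True
      have "?C = (\<Union>r q. nf_words k r q)"
        using C by (auto simp: True \<open>R = 0\<close>)
      then show ?thesis
        using two_part_all_nf_words[OF k] by simp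
    next
      case False
      have "?C = (\<Union>q. nf_words k 0 q)"
        using C by (auto simp: False \<open>R = 0\<close> powi_eq_1)
      then show ?thesis
        using two_part_nf_words_exponent_0[OF k] by simp
    qed
  next
    case False
    then have R: "(of_nat k :: rat) powi R - 1 \<noteq> 0"
      by (simp add: powi_eq_1)
    \<comment> \<open>Let b^r a^q act on the rationals by x -> k^r x + q. Then -P is the fixed point
      of g, and the centralizer is the stabilizer of -P, given by q = P (k^r - 1).\<close>
    define P where "P = Q / (of_nat k powi R - 1)"
    have Q: "Q = P * (of_nat k powi R - 1)"
      using R by (simp add: P_def)
    have eq: "q * (of_nat k powi R - 1) = Q * (of_nat k powi r - 1) \<longleftrightarrow>
        q = P * (of_nat k powi r - 1)" for q r
      using R by (simp add: P_def field_simps)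
    have C': "?C = (\<Union>r. nf_words k r (P * (of_nat k powi r - 1)))"
    proof (rule Set.set_eqI)
      fix w
      show "w \<in> ?C \<longleftrightarrow> w \<in> (\<Union>r. nf_words k r (P * (of_nat k powi r - 1)))"
        unfolding C eq by blast
    qed
    show ?thesis
    proof (cases "P = 0")
      case True
      then show ?thesis
        unfolding C' using two_part_nf_words_0[OF k] by simp
    next
      case False
      have "P * (of_nat k powi R - 1) \<in> kadic k"
        unfolding Q[symmetric] Q_def using bs_class_eq_exp[OF k] by blast
      then show ?thesis
        unfolding C' by (rule two_part_cyclic[OF k \<open>R \<noteq> 0\<close> False])
    qed
  qed
  then show ?thesis
    by (rule two_part_EDT0L[OF finite_letters])
qed

end
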